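(* Let $d\ge2$, let $\phi(\varrho)=\sqrt{1+\varrho^2}$, and for measurable $f:\mathbb{R}^d\to\mathbb{C}$ let $$\mathfrak{I}_2(f)=\int_{(\mathbb{R}^d)^2}\phi(|\xi_1|)\phi(|\xi_2|)|\widehat f(\xi_1)|^2|\widehat f(\xi_2)|^2K(\xi)\,\mathrm{d}\xi,\qquad K(\xi)=\frac{(\phi(|\xi_1|)\phi(|\xi_2|)-\xi_1\cdot\xi_2-1)^{\frac{d-2}{2}}}{(\phi(|\xi_1|)\phi(|\xi_2|)-\xi_1\cdot\xi_2+1)^{\frac12}}.$$ If $\mathfrak{I}_2(f)<\infty$, then the function $Q:(0,\infty)\to\mathbb{R}$, $$Q(t)=\frac{|\mathbb{S}^{d-1}|}{2^{\frac{d-1}{2}}(2\pi)^{3d-1}}\mathfrak{I}_2(e^{-t\sqrt{1-\Delta}}f)-\|e^{is\sqrt{1-\Delta}}e^{-t\sqrt{1-\Delta}}f\|_{L^4(\mathbb{R}\times\mathbb{R}^d)}^4,$$ is completely monotone (decreasing).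
   Context: Fourier transform convention: $\widehat f(\xi)=\int_{\mathbb{R}^d}f(x)e^{-ix\cdot\xi}\,\mathrm{d}x$. $\widehat{e^{-t\sqrt{1-\Delta}}f}(\xi)=e^{-t\sqrt{1+|\xi|^2}}\widehat f(\xi)$ for $t>0$, and $e^{is\sqrt{1-\Delta}}h$ denotes the function $(s,x)\mapsto(e^{is\sqrt{1-\Delta}}h)(x)$ with Fourier transform in $x$ equal to $e^{is\sqrt{1+|\xi|^2}}\widehat h(\xi)$ (Klein–Gordon propagator). $|\mathbb{S}^{d-1}|$ is the surface area of the unit sphere in $\mathbb{R}^d$. A function $Q:(0,\infty)\to\mathbb{R}$ is completely monotone (decreasing) if it is infinitely differentiable and $(-1)^kQ^{(k)}(t)\ge0$ for all $t>0$ and all positive integers $k$. *)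

theory Defs
  imports "HOL-Analysis.Analysis"
begin

definition KG_phi :: "real \<Rightarrow> real" where
  "KG_phi r = sqrt (1 + r\<^sup>2)"

definition fourier :: "('a::euclidean_space \<Rightarrow> complex) \<Rightarrow> 'a \<Rightarrow> complex" where
  "fourier g \<xi> = (LINT x|lborel. g x * cis (- (x \<bullet> \<xi>)))"

text \<open>F is the Fourier transform of f in the weak (distributional / multiplication
  formula) sense: int f hat g = int F g for all g in L1 and L2.  This covers f in L1 + L2
  and determines F almost everywhere.\<close>
definition has_fourier :: "('a::euclidean_space \<Rightarrow> complex) \<Rightarrow> ('a \<Rightarrow> complex) \<Rightarrow> bool" where
  "has_fourier f F \<longleftrightarrow> F \<in> borel_measurable lborel \<and>
     (\<forall>g::'a \<Rightarrow> complex. integrable lborel g \<and> integrable lborel (\<lambda>x. (cmod (g x))\<^sup>2) \<longrightarrow>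
        integrable lborel (\<lambda>x. f x * fourier g x) \<and>
        integrable lborel (\<lambda>\<xi>. F \<xi> * g \<xi>) \<and>
        (LINT x|lborel. f x * fourier g x) = (LINT \<xi>|lborel. F \<xi> * g \<xi>))"

text \<open>The kernel K(xi1, xi2); the power (d-2)/2 is written as (sqrt _)^(d-2).\<close>
definition KG_kernel :: "'a::euclidean_space \<Rightarrow> 'a \<Rightarrow> real" where
  "KG_kernel x y =
     (sqrt (KG_phi (norm x) * KG_phi (norm y) - x \<bullet> y - 1)) ^ (DIM('a) - 2) /
      sqrt (KG_phi (norm x) * KG_phi (norm y) - x \<bullet> y + 1)"

text \<open>I_2 expressed through the Fourier transform F = hat f of its argument.\<close>
definition I2hat :: "('a::euclidean_space \<Rightarrow> complex) \<Rightarrow> ennreal" where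
  "I2hat F = (\<integral>\<^sup>+ z. ennreal (KG_phi (norm (fst z)) * KG_phi (norm (snd z)) *
        (cmod (F (fst z)))\<^sup>2 * (cmod (F (snd z)))\<^sup>2 * KG_kernel (fst z) (snd z))
      \<partial>(lborel \<Otimes>\<^sub>M lborel))"

text \<open>(e^{is sqrt(1-Delta)} e^{-t sqrt(1-Delta)} f)(x), where F = hat f: the function
  whose Fourier transform in x is e^{is phi} e^{-t phi} F, given by the (absolutely
  convergent) inverse Fourier integral.\<close>
definition KG_evolve :: "('a::euclidean_space \<Rightarrow> complex) \<Rightarrow> real \<Rightarrow> real \<Rightarrow> 'a \<Rightarrow> complex" where
  "KG_evolve F t s x = (1 / (2 * pi) ^ DIM('a)) *
     (LINT \<xi>|lborel. cis (x \<bullet> \<xi>) * cis (s * KG_phi (norm \<xi>)) *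
        complex_of_real (exp (- t * KG_phi (norm \<xi>))) * F \<xi>)"

definition L4pow4 :: "('a::euclidean_space \<Rightarrow> complex) \<Rightarrow> real \<Rightarrow> ennreal" where
  "L4pow4 F t = (\<integral>\<^sup>+ z. ennreal ((cmod (KG_evolve F t (fst z) (snd z))) ^ 4)
      \<partial>(lborel \<Otimes>\<^sub>M (lborel :: 'a measure)))"

definition sphere_area :: "nat \<Rightarrow> real" where
  "sphere_area d = 2 * pi powr (real d / 2) / Gamma (real d / 2)"

definition completely_monotone :: "(real \<Rightarrow> real) \<Rightarrow> bool" where
  "completely_monotone Q \<longleftrightarrow>
     (\<forall>k t. t > 0 \<longrightarrow> ((deriv ^^ k) Q has_real_derivative (deriv ^^ Suc k) Q t) (at t)) \<and>
     (\<forall>k t. k \<ge> 1 \<longrightarrow> t > 0 \<longrightarrow> (-1) ^ k * (deriv ^^ k) Q t \<ge> 0)"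

end

theory Submission
  imports Defs "HOL-Probability.Probability"
begin

text \<open>The space-time Fourier transform of \<open>u\<^sup>2\<close> is the push-forward of
  \<open>F \<otimes> F\<close> under \<open>(\<xi>\<^sub>1, \<xi>\<^sub>2) \<mapsto> (\<phi>\<^sub>1 + \<phi>\<^sub>2, \<xi>\<^sub>1 + \<xi>\<^sub>2)\<close>, so the \<open>L\<^sup>4\<close> norm is a
  quadruple integral of \<open>F\<^sub>1 F\<^sub>2 cnj (F\<^sub>3 F\<^sub>4)\<close> over pairs with equal total energy and momentum, and the
  kernel \<open>K\<close> is, up to a constant, the density of the push-forward of
  \<open>d\<xi>\<^sub>1 d\<xi>\<^sub>2 / (\<phi>\<^sub>1 \<phi>\<^sub>2)\<close>. Hence the deficit is half the integral of
  \<open>exp (- t (\<phi>\<^sub>1 + \<phi>\<^sub>2 + \<phi>\<^sub>3 + \<phi>\<^sub>4))\<close> times a square (Lagrange's identity for Cauchy-Schwarz), a Laplace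
  transform of a positive measure. To avoid the singular constraint, \<open>|u|\<^sup>4\<close> is integrated against a
  Gaussian of variance \<open>1 / \<epsilon>\<close>, which turns the delta function into a narrow Gaussian; the
  regularised deficits are Laplace transforms, and a pointwise limit of completely
  monotone functions is completely monotone.\<close>

section \<open>Limits of completely monotone functions\<close>

text \<open>Two integrability facts carry all exchanges of integrals. The damped \<open>F\<close>
  lies in L1 because the exponential is an admissible test function in \<open>has_fourier\<close>;
  the damped \<open>phi x * (cmod (F x))^2\<close> is integrable because finiteness of I_2 with one
  frequency frozen controls \<open>F\<close> away from that frequency. The L4 norm, in contrast, is
  not known to be finite at the outset: only its regularised versions are, and finiteness comes out
  of the comparison with the diagonal term. The diagonal term is weighted by the ratio of
  \<open>phi * phi\<close> for the two pairs, so that integrating out the second pair leaves exactly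
  the push-forward density, evaluated near the first pair. The constant: four inverse Fourier
  integrals give (2 pi)^(-4d), the mass of the Gaussian in dimension d + 1 gives (2 pi)^(d + 1), and
  together they leave (2 pi)^(-(3d - 1)). The power of 2 comes from rewriting the density through
  \<open>K\<close>. Derivatives are carried as an explicit sequence and compared with
  \<open>deriv\<close> only at the end, since limits and integrals are available for each order
  separately.\<close>

definition cm_chain :: "(nat \<Rightarrow> real \<Rightarrow> real) \<Rightarrow> bool" where
  "cm_chain f \<longleftrightarrow>
     (\<forall>k t. t > 0 \<longrightarrow> (f k has_real_derivative f (Suc k) t) (at t)) \<and>
     (\<forall>k t. t > 0 \<longrightarrow> (-1) ^ k * f k t \<ge> 0)"

lemma cm_chain_deriv:
  "cm_chain f \<Longrightarrow> t > 0 \<Longrightarrow> (f k has_real_derivative f (Suc k) t) (at t)"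
  by (simp add: cm_chain_def)

lemma cm_chain_nonneg: "cm_chain f \<Longrightarrow> t > 0 \<Longrightarrow> (-1) ^ k * f k t \<ge> 0"
  by (simp add: cm_chain_def)

text \<open>Up to sign the derivatives form a chain again, so whatever is proved for the orders 0, 1
  and 2 holds from any order onwards.\<close>

lemma cm_chain_shift:
  assumes "cm_chain f"
  shows "cm_chain (\<lambda>k t. (-1) ^ j * f (k + j) t)"
  unfolding cm_chain_def
proof (intro conjI allI impI)
  fix k and t :: real assume t: "t > 0"
  show "((\<lambda>t. (-1) ^ j * f (k + j) t) has_real_derivative (-1) ^ j * f (Suc k + j) t) (at t)"
    using cm_chain_deriv[OF assms t, of "k + j"] by (auto intro!: DERIV_cmult)
  show "0 \<le> (-1) ^ k * ((-1) ^ j * f (k + j) t)"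
    using cm_chain_nonneg[OF assms t, of "k + j"] by (simp add: power_add mult_ac)
qed

lemma cm_chain_antimono:
  assumes "cm_chain f" "0 < s" "s \<le> t"
  shows "f 0 t \<le> f 0 s"
proof (rule DERIV_nonpos_imp_nonincreasing[OF assms(3)])
  fix x assume "s \<le> x"
  then have x: "x > 0" using assms by simp
  show "\<exists>y. (f 0 has_real_derivative y) (at x) \<and> y \<le> 0"
    using cm_chain_deriv[OF assms(1) x, of 0] cm_chain_nonneg[OF assms(1) x, of 1] by auto
qed

text \<open>By the mean value theorem the slope on the interval from t/2 to t is attained at some
  \<open>c\<close>, and \<open>- f 1\<close> decreases. Bounding a derivative by values of the
  function costs a retreat to t/2; this is how pointwise convergence of values comes to control
  derivatives.\<close>

lemma cm_chain_deriv_bound: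
  assumes f: "cm_chain f" and t: "0 < t"
  shows "- f 1 t \<le> 2 / t * f 0 (t / 2)"
proof -
  obtain c where c: "t / 2 < c" "c < t" "f 0 t - f 0 (t / 2) = (t - t / 2) * f 1 c"
    using MVT2[of "t / 2" t "f 0" "f 1"] cm_chain_deriv[OF f, of _ 0] t by force
  have "- f 1 t \<le> - f 1 c"
    using cm_chain_antimono[OF cm_chain_shift[OF f, of 1], of c t] c t by simp
  also have "\<dots> = 2 / t * (f 0 (t / 2) - f 0 t)"
    using c(3) t by (simp add: field_simps)
  also have "\<dots> \<le> 2 / t * f 0 (t / 2)"
    using cm_chain_nonneg[OF f t, of 0] t by (intro mult_left_mono) auto
  finally show ?thesis .
qed

lemma cm_chain_deriv2_bound:
  assumes f: "cm_chain f" and t: "0 < t"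
  shows "f 2 t \<le> 8 / t\<^sup>2 * f 0 (t / 4)"
proof -
  have "f 2 t \<le> 2 / t * - f 1 (t / 2)"
    using cm_chain_deriv_bound[OF cm_chain_shift[OF f, of 1] t] by (simp add: numeral_2_eq_2)
  also have "\<dots> \<le> 2 / t * (2 / (t / 2) * f 0 (t / 2 / 2))"
    using cm_chain_deriv_bound[OF f, of "t / 2"] t by (intro mult_left_mono) auto
  finally show ?thesis using t by (simp add: power2_eq_square)
qed

lemma cm_chain_taylor:
  assumes f: "cm_chain f" and t: "0 < t" and h: "\<bar>h\<bar> < t / 2"
  shows "\<bar>f 0 (t + h) - f 0 t - h * f 1 t\<bar> \<le> 32 / t\<^sup>2 * f 0 (t / 8) * h\<^sup>2"
proof -
  \<comment> \<open>The bound of the second derivative taken at t/2: 8 / (t/2)^2 = 32 / t^2, and a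
    quarter of t/2 is t/8. Since \<open>f 2\<close> decreases, it serves for all arguments from t/2
    on.\<close>
  define M where "M = 32 / t\<^sup>2 * f 0 (t / 8)"
  have bound: "\<bar>f 2 c\<bar> \<le> M" if c: "t / 2 \<le> c" for c
  proof -
    have "f 2 c \<le> f 2 (t / 2)"
      using cm_chain_antimono[OF cm_chain_shift[OF f, of 2], of "t / 2" c] c t by (simp add: numeral_2_eq_2)
    also have "\<dots> \<le> M"
      using cm_chain_deriv2_bound[OF f, of "t / 2"] t
      by (simp add: M_def power2_eq_square)
    finally show ?thesis using cm_chain_nonneg[OF f, of c 2] c t by simp
  qed
  have lip: "\<bar>f 1 x - f 1 t\<bar> \<le> M * \<bar>x - t\<bar>" if x: "t / 2 \<le> x" for x
  proof -
    have "norm (f 1 x - f 1 t) \<le> M * norm (x - t)"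
    proof (rule field_differentiable_bound[where S = "{t/2..}" and f' = "f 2"])
      fix z assume "z \<in> {t/2..}"
      then show "(f 1 has_field_derivative f 2 z) (at z within {t / 2..})" "norm (f 2 z) \<le> M"
        using cm_chain_deriv[OF f, of z 1] t bound[of z]
        by (auto simp: numeral_2_eq_2 intro: has_field_derivative_at_within)
    qed (use x t in auto)
    then show ?thesis by simp
  qed
  have "norm ((f 0 (t + h) - (t + h) * f 1 t) - (f 0 t - t * f 1 t)) \<le> (M * \<bar>h\<bar>) * norm ((t + h) - t)"
  proof (rule field_differentiable_bound[where S = "{t - \<bar>h\<bar>..t + \<bar>h\<bar>}" and f' = "\<lambda>x. f 1 x - f 1 t"])
    fix z assume z: "z \<in> {t - \<bar>h\<bar>..t + \<bar>h\<bar>}"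
    then have z0: "t / 2 \<le> z" "z > 0" using h t by auto
    show "((\<lambda>x. f 0 x - x * f 1 t) has_field_derivative f 1 z - f 1 t) (at z within {t - \<bar>h\<bar>..t + \<bar>h\<bar>})"
      using has_field_derivative_at_within[OF cm_chain_deriv[OF f z0(2), of 0]]
      by (auto intro!: derivative_eq_intros)
    have "M \<ge> 0" using bound[of t] t by linarith
    then have "M * \<bar>z - t\<bar> \<le> M * \<bar>h\<bar>" using z by (intro mult_left_mono) auto
    then show "norm (f 1 z - f 1 t) \<le> M * \<bar>h\<bar>" using lip[OF z0(1)] by simp
  qed auto
  then show ?thesis by (simp add: M_def algebra_simps power2_eq_square)
qed

text \<open>The Taylor remainder is uniform in \<open>n\<close>, because the values at t/8 converge
  and hence stay bounded. Divided by a small \<open>h\<close>, it makes the derivatives Cauchy; the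
  same inequality passed to the limit gives differentiability of \<open>g\<close>.\<close>

lemma cm_chain_limit_step:
  assumes f: "\<And>n. cm_chain (f n)" and lim: "\<And>t. t > 0 \<Longrightarrow> (\<lambda>n. f n 0 t) \<longlonglongrightarrow> g t" and t: "t > 0"
  shows "\<exists>l. (\<lambda>n. f n 1 t) \<longlonglongrightarrow> l \<and> (g has_real_derivative l) (at t)"
proof -
  have "bounded (range (\<lambda>n. f n 0 (t / 8)))"
    using lim[of "t / 8"] t by (intro convergent_imp_bounded) auto
  then obtain B where B: "\<And>n. \<bar>f n 0 (t / 8)\<bar> \<le> B"
    by (auto simp: bounded_iff)
  \<comment> \<open>The summand 1 makes \<open>M\<close> strictly positive, as it is going to be a
    divisor.\<close>
  define M where "M = 32 / t\<^sup>2 * B + 1"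
  have B0: "B \<ge> 0" using B[of 0] by linarith
  then have M: "M > 0" using t by (simp add: M_def add_nonneg_pos)
  have est: "\<bar>f n 0 (t + h) - f n 0 t - h * f n 1 t\<bar> \<le> M * h\<^sup>2" if "\<bar>h\<bar> < t / 2" for n h
  proof -
    have "\<bar>f n 0 (t + h) - f n 0 t - h * f n 1 t\<bar> \<le> 32 / t\<^sup>2 * f n 0 (t / 8) * h\<^sup>2"
      by (rule cm_chain_taylor[OF f t that])
    also have "\<dots> \<le> M * h\<^sup>2"
    proof (rule mult_right_mono)
      have "32 / t\<^sup>2 * f n 0 (t / 8) \<le> 32 / t\<^sup>2 * B"
        using B[of n] by (intro mult_left_mono) auto
      then show "32 / t\<^sup>2 * f n 0 (t / 8) \<le> M" by (simp add: M_def)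
    qed auto
    finally show ?thesis .
  qed
  have "Cauchy (\<lambda>n. f n 1 t)"
  proof (rule metric_CauchyI)
    fix e :: real assume e: "e > 0"
    \<comment> \<open>t/3 stays inside the range of the Taylor estimate. After division by
      \<open>h\<close> the two remainders contribute at most e/4 each and the difference of values
      another e/4, which is less than \<open>e\<close> in total.\<close>
    define h where "h = min (t / 3) (e / (4 * M))"
    have h: "0 < h" "\<bar>h\<bar> < t / 2" "M * h \<le> e / 4"
      using t e M by (auto simp: h_def field_simps min_def)
    have th: "t + h > 0" using t h by linarith
    have "Cauchy (\<lambda>n. f n 0 (t + h) - f n 0 t)"
      by (rule LIMSEQ_imp_Cauchy[OF tendsto_diff[OF lim[OF th] lim[OF t]]])
    then obtain N where N: "\<And>m n. m \<ge> N \<Longrightarrow> n \<ge> N \<Longrightarrow>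
        dist (f m 0 (t + h) - f m 0 t) (f n 0 (t + h) - f n 0 t) < h * (e / 4)"
      using metric_CauchyD[of _ "h * (e / 4)"] h e by fastforce
    show "\<exists>N. \<forall>m\<ge>N. \<forall>n\<ge>N. dist (f m 1 t) (f n 1 t) < e"
    proof (intro exI[of _ N] allI impI)
      fix m n assume mn: "m \<ge> N" "n \<ge> N"
      have "h * \<bar>f m 1 t - f n 1 t\<bar> = \<bar>h * f m 1 t - h * f n 1 t\<bar>"
        using h by (simp add: abs_mult right_diff_distrib[symmetric])
      also have "\<dots> < h * (e / 4) + 2 * (M * h\<^sup>2)"
        using est[OF h(2), of m] est[OF h(2), of n] N[OF mn] unfolding dist_real_def by linarith
      also have "M * h\<^sup>2 \<le> h * (e / 4)"
        using h mult_left_mono[OF h(3), of h] by (simp add: power2_eq_square mult_ac)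
      finally have "h * \<bar>f m 1 t - f n 1 t\<bar> < h * e" using h e by (simp add: field_simps)
      then show "dist (f m 1 t) (f n 1 t) < e" using h by (simp add: dist_real_def)
    qed
  qed
  then obtain l where l: "(\<lambda>n. f n 1 t) \<longlonglongrightarrow> l"
    using Cauchy_convergent convergent_def by blast
  have est': "\<bar>g (t + h) - g t - h * l\<bar> \<le> M * h\<^sup>2" if h: "\<bar>h\<bar> < t / 2" for h
  proof (rule LIMSEQ_le_const2)
    have "t + h > 0" using h t by linarith
    then show "(\<lambda>n. \<bar>f n 0 (t + h) - f n 0 t - h * f n 1 t\<bar>) \<longlonglongrightarrow> \<bar>g (t + h) - g t - h * l\<bar>"
      by (intro tendsto_intros lim t l)
  qed (use est[OF h] in auto)
  have "((\<lambda>h. (g (t + h) - g t) / h - l) \<longlongrightarrow> 0) (at 0)"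
  proof (rule Lim_null_comparison)
    have "\<forall>\<^sub>F h in at 0. h \<noteq> 0 \<and> \<bar>h\<bar> < t / 2"
      using t by (auto simp: eventually_at intro!: exI[of _ "t / 2"])
    then show "\<forall>\<^sub>F h in at 0. norm ((g (t + h) - g t) / h - l) \<le> M * \<bar>h\<bar>"
    proof eventually_elim
      case (elim h)
      have "norm ((g (t + h) - g t) / h - l) = \<bar>g (t + h) - g t - h * l\<bar> / \<bar>h\<bar>"
        using elim by (simp add: abs_divide[symmetric] diff_divide_distrib)
      also have "\<dots> \<le> M * h\<^sup>2 / \<bar>h\<bar>" using elim est'[of h] by (intro divide_right_mono) auto
      also have "\<dots> = M * \<bar>h\<bar>" using elim by (simp add: power2_eq_square field_simps abs_if)
      finally show ?case .
    qed
    show "((\<lambda>h. M * \<bar>h\<bar>) \<longlongrightarrow> 0) (at 0)" by (auto intro!: tendsto_eq_intros)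
  qed
  then have "(g has_real_derivative l) (at t)"
    unfolding DERIV_def using LIM_zero_iff by blast
  with l show ?thesis by blast
qed

text \<open>Induction on the order: once order \<open>k\<close> converges on the half-line, the
  signed shift turns it into order 0 of another chain, and the previous step yields convergence of
  order \<open>k + 1\<close> together with the derivative.\<close>

lemma cm_chain_limit:
  assumes f: "\<And>n. cm_chain (f n)" and lim: "\<And>t. t > 0 \<Longrightarrow> (\<lambda>n. f n 0 t) \<longlonglongrightarrow> g t"
  shows "\<exists>h. cm_chain h \<and> (\<forall>t>0. h 0 t = g t)"
proof -
  define h where "h k t = Topological_Spaces.lim (\<lambda>n. f n k t)" for k t
  have step: "\<exists>l. (\<lambda>n. f n (Suc k) t) \<longlonglongrightarrow> l \<and> (G has_real_derivative l) (at t)"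
    if G: "\<And>t. t > 0 \<Longrightarrow> (\<lambda>n. f n k t) \<longlonglongrightarrow> G t" and t: "t > 0" for k t G
  proof -
    have "\<exists>l. (\<lambda>n. (-1) ^ k * f n (1 + k) t) \<longlonglongrightarrow> l \<and>
        ((\<lambda>t. (-1) ^ k * G t) has_real_derivative l) (at t)"
      using G by (intro cm_chain_limit_step[of "\<lambda>n j t. (-1) ^ k * f n (j + k) t"]
          cm_chain_shift f t tendsto_mult_left) auto
    then obtain l where l: "(\<lambda>n. (-1) ^ k * f n (1 + k) t) \<longlonglongrightarrow> l"
        "((\<lambda>t. (-1) ^ k * G t) has_real_derivative l) (at t)" by blast
    have sq: "(-1) ^ k * ((-1) ^ k * x) = x" for x :: real
      by (simp add: mult.assoc[symmetric] power_mult_distrib[symmetric])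
    show ?thesis
      using tendsto_mult_left[OF l(1), of "(-1) ^ k"] DERIV_cmult[OF l(2), of "(-1) ^ k"]
      unfolding sq by auto
  qed
  have lims: "\<forall>t>0. (\<lambda>n. f n k t) \<longlonglongrightarrow> h k t" for k
  proof (induction k)
    case 0
    show ?case using lim limI unfolding h_def by (metis (no_types, lifting))
  next
    case (Suc k)
    show ?case using step[of k "h k"] Suc limI unfolding h_def by (metis (no_types, lifting))
  qed
  have "cm_chain h"
    unfolding cm_chain_def
  proof (intro conjI allI impI)
    fix k and t :: real assume t: "t > 0"
    obtain l where l: "(\<lambda>n. f n (Suc k) t) \<longlonglongrightarrow> l" "(h k has_real_derivative l) (at t)"
      using step[of k "h k" t] lims t by blast
    moreover have "l = h (Suc k) t" using l(1) lims t LIMSEQ_unique by blast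
    ultimately show "(h k has_real_derivative h (Suc k) t) (at t)" by simp
    show "0 \<le> (-1) ^ k * h k t"
      using lims t cm_chain_nonneg[OF f t]
      by (intro LIMSEQ_le_const[OF tendsto_mult_left[of "\<lambda>n. f n k t"]]) auto
  qed
  moreover have "h 0 t = g t" if "t > 0" for t
    using lims lim that LIMSEQ_unique by blast
  ultimately show ?thesis by blast
qed

text \<open>\<open>Q\<close> is known only for positive arguments. That half-line is open, so the
  iterated \<open>deriv\<close> at a positive point sees nothing else.\<close>

lemma completely_monotoneI:
  assumes h: "cm_chain h" and eq: "\<And>t. t > 0 \<Longrightarrow> h 0 t = Q t"
  shows "completely_monotone Q"
proof -
  have D: "\<forall>t>0. (deriv ^^ k) Q t = h k t" for k
  proof (induction k)
    case 0 then show ?case using eq by simp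
  next
    case (Suc k)
    show ?case
    proof (intro allI impI)
      fix t :: real assume t: "t > 0"
      have "((deriv ^^ k) Q has_real_derivative h (Suc k) t) (at t)"
        using cm_chain_deriv[OF h t, of k] t Suc
        by (auto intro: has_field_derivative_transform_within_open[OF _ open_greaterThan[of 0]])
      then show "(deriv ^^ Suc k) Q t = h (Suc k) t" by (simp add: DERIV_imp_deriv)
    qed
  qed
  show ?thesis
    unfolding completely_monotone_def
  proof (intro conjI allI impI)
    fix k and t :: real assume t: "t > 0"
    have "((deriv ^^ k) Q has_real_derivative h (Suc k) t) (at t)"
      using cm_chain_deriv[OF h t, of k] t D[of k]
      by (auto intro: has_field_derivative_transform_within_open[OF _ open_greaterThan[of 0]])
    then show "((deriv ^^ k) Q has_real_derivative (deriv ^^ Suc k) Q t) (at t)"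
      using D[of "Suc k"] t by simp
    show "0 \<le> (-1) ^ k * (deriv ^^ k) Q t" using D[of k] t cm_chain_nonneg[OF h t] by simp
  qed
qed

section \<open>Laplace transforms of positive measures\<close>

lemma power_times_exp_le:
  fixes x t :: real
  assumes "x \<ge> 0" "t > 0"
  shows "x ^ k * exp (- t * x) \<le> fact k / t ^ k"
proof -
  have "(t * x) ^ k /\<^sub>R fact k \<le> (\<Sum>n. (t * x) ^ n /\<^sub>R fact n)"
    using sum_le_suminf[OF summable_exp_generic[of "t * x"], of "{k}"] assms by simp
  then have "(t * x) ^ k / fact k \<le> exp (t * x)"
    by (simp add: exp_def divide_inverse mult.commute)
  then show ?thesis
    using assms by (simp add: exp_minus field_simps)
qed

text \<open>Half of the exponential absorbs the power of \<open>\<Phi>\<close> that each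
  differentiation produces; the other half is integrable by assumption at t/2. The same function at
  t/2 dominates the difference quotients.\<close>

lemma cm_chain_laplace:
  fixes \<Phi> w :: "'b \<Rightarrow> real"
  assumes [measurable]: "\<Phi> \<in> borel_measurable M" "w \<in> borel_measurable M"
    and \<Phi>: "\<And>x. \<Phi> x \<ge> 0" and w: "\<And>x. w x \<ge> 0"
    and int: "\<And>t. t > 0 \<Longrightarrow> integrable M (\<lambda>x. exp (- t * \<Phi> x) * w x)"
  shows "cm_chain (\<lambda>k t. \<integral>x. (- \<Phi> x) ^ k * (exp (- t * \<Phi> x) * w x) \<partial>M)"
proof -
  have bound: "\<Phi> x ^ k * (exp (- t * \<Phi> x) * w x) \<le> fact k / (t / 2) ^ k * (exp (- (t / 2) * \<Phi> x) * w x)"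
    if "t > 0" for k t x
  proof -
    have e: "exp (- t * \<Phi> x) = exp (- (t / 2) * \<Phi> x) * exp (- (t / 2) * \<Phi> x)"
      by (subst exp_add[symmetric], rule arg_cong[where f = exp]) simp
    have "\<Phi> x ^ k * (exp (- t * \<Phi> x) * w x)
        = (\<Phi> x ^ k * exp (- (t / 2) * \<Phi> x)) * (exp (- (t / 2) * \<Phi> x) * w x)"
      unfolding e by (simp only: mult_ac)
    also have "\<dots> \<le> fact k / (t / 2) ^ k * (exp (- (t / 2) * \<Phi> x) * w x)"
      using power_times_exp_le[OF \<Phi>, of "t / 2" x k] that w by (intro mult_right_mono) auto
    finally show ?thesis .
  qed
  have intk: "integrable M (\<lambda>x. (- \<Phi> x) ^ k * (exp (- t * \<Phi> x) * w x))" if "t > 0" for k t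
  proof (rule Bochner_Integration.integrable_bound)
    show "integrable M (\<lambda>x. fact k / (t / 2) ^ k * (exp (- (t / 2) * \<Phi> x) * w x))"
      using int[of "t / 2"] that by simp
    show "AE x in M. norm ((- \<Phi> x) ^ k * (exp (- t * \<Phi> x) * w x))
        \<le> norm (fact k / (t / 2) ^ k * (exp (- (t / 2) * \<Phi> x) * w x))"
      using bound[OF that, of _ k] \<Phi> w that by (auto simp: abs_mult power_abs)
  qed measurable
  show ?thesis
    unfolding cm_chain_def
  proof (intro conjI allI impI)
    fix k and t :: real assume t: "t > 0"
    show "0 \<le> (-1) ^ k * (\<integral>x. (- \<Phi> x) ^ k * (exp (- t * \<Phi> x) * w x) \<partial>M)"
      using \<Phi> w by (subst integral_mult_right_zero[symmetric], intro integral_nonneg_AE)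
         (auto simp: mult.assoc[symmetric] power_mult_distrib[symmetric])
    let ?f = "\<lambda>t x. (- \<Phi> x) ^ k * (exp (- t * \<Phi> x) * w x)"
    let ?f' = "\<lambda>x. (- \<Phi> x) ^ Suc k * (exp (- t * \<Phi> x) * w x)"
    have "((\<lambda>h. ((\<integral>x. ?f (t + h) x \<partial>M) - (\<integral>x. ?f t x \<partial>M)) / h) \<longlongrightarrow> (\<integral>x. ?f' x \<partial>M)) (at 0)"
      unfolding tendsto_at_iff_sequentially comp_def
    proof (intro allI impI)
      fix X :: "nat \<Rightarrow> real" assume X0: "\<forall>i. X i \<in> UNIV - {0}" and X: "X \<longlonglongrightarrow> 0"
      have "\<forall>\<^sub>F n in sequentially. \<bar>X n\<bar> < t / 2"
        using tendstoD[OF X, of "t / 2"] t by (simp add: dist_real_def)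
      then obtain N where N: "\<And>n. n \<ge> N \<Longrightarrow> \<bar>X n\<bar> < t / 2" by (auto simp: eventually_sequentially)
      \<comment> \<open>Dropping an initial segment keeps every step below t/2, so that all
        difference quotients have the common majorant with exponent t/2.\<close>
      define Y where "Y n = X (n + N)" for n
      have Y: "Y \<longlonglongrightarrow> 0" "\<And>n. Y n \<noteq> 0" "\<And>n. \<bar>Y n\<bar> < t / 2"
        using X0 N LIMSEQ_ignore_initial_segment[OF X, of N] unfolding Y_def by auto
      have tY: "t + Y n > 0" for n using Y(3)[of n] t by linarith
      have "(\<lambda>n. \<integral>x. (?f (t + Y n) x - ?f t x) / Y n \<partial>M) \<longlonglongrightarrow> (\<integral>x. ?f' x \<partial>M)"
      proof (rule integral_dominated_convergence)
        show "integrable M (\<lambda>x. \<Phi> x ^ Suc k * (exp (- (t / 2) * \<Phi> x) * w x))"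
          using integrable_abs[OF intk[of "t / 2" "Suc k"]] t \<Phi> w by (simp add: abs_mult power_abs)
        have der: "((\<lambda>s. ?f s x) has_real_derivative (- \<Phi> x) ^ Suc k * (exp (- s * \<Phi> x) * w x)) (at s)" for s x
          by (auto intro!: derivative_eq_intros)
        show "AE x in M. (\<lambda>n. (?f (t + Y n) x - ?f t x) / Y n) \<longlonglongrightarrow> ?f' x"
          using der[of _ t] Y(1,2) unfolding DERIV_def tendsto_at_iff_sequentially comp_def by auto
        show "AE x in M. norm ((?f (t + Y n) x - ?f t x) / Y n) \<le> \<Phi> x ^ Suc k * (exp (- (t / 2) * \<Phi> x) * w x)" for n
        proof (rule AE_I2)
          fix x
          have "norm (?f (t + Y n) x - ?f t x) \<le> \<Phi> x ^ Suc k * (exp (- (t / 2) * \<Phi> x) * w x) * norm ((t + Y n) - t)"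
          proof (rule field_differentiable_bound[where S = "{t/2..}"])
            show "((\<lambda>s. ?f s x) has_real_derivative (- \<Phi> x) ^ Suc k * (exp (- s * \<Phi> x) * w x)) (at s within {t/2..})" for s
              using der has_field_derivative_at_within by blast
            fix s assume s: "s \<in> {t / 2..}"
            have "- s * \<Phi> x \<le> - (t / 2) * \<Phi> x"
              using s \<Phi> by (intro mult_right_mono) auto
            then show "norm ((- \<Phi> x) ^ Suc k * (exp (- s * \<Phi> x) * w x)) \<le> \<Phi> x ^ Suc k * (exp (- (t / 2) * \<Phi> x) * w x)"
              using \<Phi> w by (auto simp: abs_mult power_abs intro!: mult_left_mono mult_right_mono)
          qed (use Y(3)[of n] t in auto)
          then show "norm ((?f (t + Y n) x - ?f t x) / Y n) \<le> \<Phi> x ^ Suc k * (exp (- (t / 2) * \<Phi> x) * w x)"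
            using Y(2)[of n] by (simp add: divide_le_eq abs_divide)
        qed
      qed measurable
      moreover have "(\<integral>x. (?f (t + Y n) x - ?f t x) / Y n \<partial>M) = ((\<integral>x. ?f (t + Y n) x \<partial>M) - (\<integral>x. ?f t x \<partial>M)) / Y n" for n
        using intk[OF tY, of k n] intk[OF t, of k] by simp
      ultimately have "(\<lambda>n. ((\<integral>x. ?f (t + Y n) x \<partial>M) - (\<integral>x. ?f t x \<partial>M)) / Y n) \<longlonglongrightarrow> (\<integral>x. ?f' x \<partial>M)"
        by (simp only:)
      then show "(\<lambda>n. ((\<integral>x. ?f (t + X n) x \<partial>M) - (\<integral>x. ?f t x \<partial>M)) / X n) \<longlonglongrightarrow> (\<integral>x. ?f' x \<partial>M)"
        unfolding Y_def by (rule LIMSEQ_offset)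
    qed
    then show "((\<lambda>t. \<integral>x. (- \<Phi> x) ^ k * (exp (- t * \<Phi> x) * w x) \<partial>M) has_real_derivative
          (\<integral>x. (- \<Phi> x) ^ Suc k * (exp (- t * \<Phi> x) * w x) \<partial>M)) (at t)"
      unfolding DERIV_def .
  qed
qed

section \<open>Gaussian regularisation\<close>

text \<open>The Fourier transform of \<open>exp (- e * (norm x)^2 / 2)\<close>. Its integral is (2
  pi)^DIM for every positive \<open>e\<close>, so it approximates (2 pi)^DIM times the delta
  function at 0 as \<open>e\<close> tends to 0.\<close>

definition gauss_ft :: "real \<Rightarrow> 'b::euclidean_space \<Rightarrow> real" where
  "gauss_ft e y = (sqrt (2 * pi / e)) ^ DIM('b) * exp (- (norm y)\<^sup>2 / (2 * e))"

text \<open>The characteristic function of the standard normal distribution, rescaled by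
  \<open>sqrt e\<close>.\<close>

lemma gauss_1d:
  fixes y e :: real
  assumes e: "e > 0"
  shows "integrable lborel (\<lambda>x. cis (x * y) * complex_of_real (exp (- e * x\<^sup>2 / 2)))"
    and "(LINT x|lborel. cis (x * y) * complex_of_real (exp (- e * x\<^sup>2 / 2)))
          = complex_of_real (sqrt (2 * pi / e) * exp (- y\<^sup>2 / (2 * e)))"
proof -
  define s where "s = sqrt e"
  have s: "s > 0" "s * s = e" "e = s\<^sup>2" using e by (simp_all add: s_def)
  have int: "integrable lborel (\<lambda>x. std_normal_density x *\<^sub>R cis (y / s * x))"
  proof (rule Bochner_Integration.integrable_bound)
    show "integrable lborel std_normal_density"
      using integrable_std_normal_moment[of 0] by simp
  qed (auto intro!: AE_I2 borel_measurable_continuous_onI continuous_intros simp: cis_conv_exp)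
  have "complex_of_real (exp (- (y / s)\<^sup>2 / 2)) = char std_normal_distribution (y / s)"
    by (simp add: char_std_normal_distribution)
  also have "\<dots> = (LINT x|lborel. std_normal_density x *\<^sub>R cis (y / s * x))"
    unfolding char_def by (subst integral_density) (auto simp: cis_conv_exp mult_ac normal_density_nonneg)
  finally have 1: "(LINT x|lborel. std_normal_density x *\<^sub>R cis (y / s * x)) = complex_of_real (exp (- (y / s)\<^sup>2 / 2))" ..
  let ?g = "\<lambda>x. cis (x * y) * complex_of_real (exp (- e * x\<^sup>2 / 2))"
  have g: "std_normal_density (0 + s * x) *\<^sub>R cis (y / s * (0 + s * x)) = complex_of_real (1 / sqrt (2 * pi)) * ?g x" for x
    using s by (simp add: std_normal_density_def scaleR_conv_of_real mult_ac power_mult_distrib)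
  have "integrable lborel (\<lambda>x. std_normal_density (0 + s * x) *\<^sub>R cis (y / s * (0 + s * x)))"
    by (rule lborel_integrable_real_affine[OF int]) (use s in auto)
  then have "integrable lborel (\<lambda>x. complex_of_real (sqrt (2 * pi)) * (complex_of_real (1 / sqrt (2 * pi)) * ?g x))"
    unfolding g by (rule integrable_mult_right)
  then show "integrable lborel ?g" by (simp add: mult.assoc[symmetric] flip: of_real_mult)
  have "complex_of_real (exp (- (y / s)\<^sup>2 / 2)) = \<bar>s\<bar> *\<^sub>R (LINT x|lborel. complex_of_real (1 / sqrt (2 * pi)) * ?g x)"
    unfolding 1[symmetric] g[symmetric] by (rule lborel_integral_real_affine) (use s in auto)
  also have "\<dots> = complex_of_real (s / sqrt (2 * pi)) * (LINT x|lborel. ?g x)"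
    using s by (simp add: scaleR_conv_of_real)
  finally show "(LINT x|lborel. ?g x) = complex_of_real (sqrt (2 * pi / e) * exp (- y\<^sup>2 / (2 * e)))"
    using s by (simp add: field_simps real_sqrt_divide real_sqrt_mult s_def[symmetric] power_divide flip: of_real_mult)
qed

text \<open>Both the phase and the Gaussian factorise over the coordinates, and
  \<open>lborel\<close> is the image of a product of real Lebesgue measures.\<close>

lemma gauss_fourier:
  fixes y :: "'b::euclidean_space"
  assumes e: "e > 0"
  shows "integrable lborel (\<lambda>x::'b. cis (x \<bullet> y) * complex_of_real (exp (- e * (norm x)\<^sup>2 / 2)))"
    and "(LINT x|lborel. cis (x \<bullet> y) * complex_of_real (exp (- e * (norm (x::'b))\<^sup>2 / 2)))
          = complex_of_real (gauss_ft e y)"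
proof -
  interpret product_sigma_finite "\<lambda>_::'b. lborel :: real measure"
    by unfold_locales
  let ?g = "\<lambda>x::'b. cis (x \<bullet> y) * complex_of_real (exp (- e * (norm x)\<^sup>2 / 2))"
  let ?f = "\<lambda>b x. cis (x * (y \<bullet> b)) * complex_of_real (exp (- e * x\<^sup>2 / 2))"
  let ?T = "\<lambda>f::'b \<Rightarrow> real. \<Sum>b\<in>Basis. f b *\<^sub>R b"
  let ?P = "Pi\<^sub>M (Basis::'b set) (\<lambda>_. lborel :: real measure)"
  have cis_sum: "cis (\<Sum>b\<in>A. h b) = (\<Prod>b\<in>A. cis (h b))" for h :: "'b \<Rightarrow> real" and A :: "'b set"
    by (induction A rule: infinite_finite_induct) (auto simp: cis_mult[symmetric])
  have nrm: "(norm (?T x))\<^sup>2 = (\<Sum>b\<in>Basis. (x b)\<^sup>2)" for x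
    unfolding power2_norm_eq_inner
    by (subst euclidean_inner) (simp add: power2_eq_square inner_sum_left_Basis)
  have eq: "?g (?T x) = (\<Prod>b\<in>Basis. ?f b (x b))" for x
  proof -
    have "?T x \<bullet> y = (\<Sum>b\<in>Basis. x b * (y \<bullet> b))"
      by (simp add: inner_sum_left inner_commute[of y])
    moreover have "exp (- e * (norm (?T x))\<^sup>2 / 2) = (\<Prod>b\<in>Basis. exp (- e * (x b)\<^sup>2 / 2))"
      unfolding nrm by (subst exp_sum[symmetric]) (auto simp: sum_distrib_left sum_divide_distrib)
    ultimately show ?thesis by (simp add: cis_sum prod.distrib)
  qed
  have meas[measurable]: "?T \<in> measurable ?P borel" by measurable
  have gm[measurable]: "?g \<in> borel_measurable borel"
    unfolding cis_conv_exp by (intro borel_measurable_continuous_onI continuous_intros) auto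
  have "integrable ?P (\<lambda>x. \<Prod>b\<in>Basis. ?f b (x b))"
    by (intro product_integrable_prod gauss_1d e) simp
  then have "integrable (distr ?P borel ?T) ?g"
    by (subst integrable_distr_eq) (simp_all only: eq meas gm)
  then show "integrable lborel ?g" by (simp only: lborel_eq[symmetric])
  have "integral\<^sup>L lborel ?g = integral\<^sup>L (distr ?P borel ?T) ?g" by (simp only: lborel_eq[symmetric])
  also have "\<dots> = (\<integral>x. (\<Prod>b\<in>Basis. ?f b (x b)) \<partial>?P)"
    by (subst integral_distr) (simp_all only: eq meas gm)
  also have "\<dots> = (\<Prod>b\<in>Basis. integral\<^sup>L lborel (?f b))"
    by (intro product_integral_prod gauss_1d e) simp
  also have "\<dots> = complex_of_real (\<Prod>b\<in>Basis. sqrt (2 * pi / e) * exp (- (y \<bullet> b)\<^sup>2 / (2 * e)))"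
    by (subst gauss_1d(2)[OF e]) simp
  also have "(\<Prod>b\<in>Basis. sqrt (2 * pi / e) * exp (- (y \<bullet> b)\<^sup>2 / (2 * e))) = gauss_ft e y"
  proof -
    have "(norm y)\<^sup>2 = (\<Sum>b\<in>Basis. (y \<bullet> b)\<^sup>2)"
      unfolding power2_norm_eq_inner by (subst euclidean_inner) (simp add: power2_eq_square)
    then show ?thesis
      unfolding gauss_ft_def
      by (simp add: prod.distrib exp_sum[symmetric] sum_negf sum_divide_distrib[symmetric])
  qed
  finally show "integral\<^sup>L lborel ?g = complex_of_real (gauss_ft e y)" .
qed

section \<open>Narrow Gaussians as an approximate identity\<close>

lemma gauss_ft_nonneg [simp]: "e > 0 \<Longrightarrow> gauss_ft e y \<ge> 0"
  by (simp add: gauss_ft_def)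

lemma gauss_ft_minus_commute: "gauss_ft e (x - y) = gauss_ft e (y - x)"
  by (simp add: gauss_ft_def norm_minus_commute)

lemma continuous_on_gauss_ft: "continuous_on UNIV (gauss_ft e)"
  unfolding gauss_ft_def[abs_def] divide_inverse by (intro continuous_intros)

lemma borel_measurable_gauss_ft [measurable]: "gauss_ft e \<in> borel_measurable borel"
  by (intro borel_measurable_continuous_onI continuous_on_gauss_ft)

lemma integral_std_gauss:
  shows "integrable lborel (\<lambda>y::'b::euclidean_space. gauss_ft 1 y)"
    and "(LINT y|lborel. gauss_ft 1 (y::'b)) = (2 * pi) ^ DIM('b)"
proof -
  let ?f = "\<lambda>y::'b. exp (- (norm y)\<^sup>2 / 2)"
  have "integrable lborel (\<lambda>y. complex_of_real (?f y))"
    using gauss_fourier(1)[of 1 "0::'b"] by simp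
  then have int: "integrable lborel ?f" by (simp only: complex_of_real_integrable_eq)
  have "complex_of_real (LINT y|lborel. ?f y) = complex_of_real ((sqrt (2 * pi)) ^ DIM('b))"
    using gauss_fourier(2)[of 1 "0::'b"] by (simp add: gauss_ft_def)
  then have eq: "(LINT y|lborel. ?f y) = (sqrt (2 * pi)) ^ DIM('b)"
    by (simp only: of_real_eq_iff)
  show "integrable lborel (\<lambda>y::'b. gauss_ft 1 y)"
    unfolding gauss_ft_def using int by simp
  show "(LINT y|lborel. gauss_ft 1 (y::'b)) = (2 * pi) ^ DIM('b)"
  proof -
    have "(LINT y|lborel. gauss_ft 1 (y::'b)) = (sqrt (2 * pi)) ^ DIM('b) * (LINT y|lborel. ?f y)"
      unfolding gauss_ft_def by simp
    also have "\<dots> = (sqrt (2 * pi) * sqrt (2 * pi)) ^ DIM('b)"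
      unfolding eq by (simp only: power_mult_distrib)
    finally show ?thesis by (simp only: real_sqrt_mult_self) simp
  qed
qed

text \<open>The substitution \<open>P = P0 + sqrt e *\<^sub>R y\<close> fixes the Gaussian and moves
  \<open>e\<close> into the argument of \<open>B\<close>, where boundedness gives a majorant and
  continuity gives the limit.\<close>

lemma gauss_convolution_scale:
  fixes B :: "'b::euclidean_space \<Rightarrow> real"
  assumes e: "e > 0" and [measurable]: "B \<in> borel_measurable borel"
    and B: "\<And>P. 0 \<le> B P" "\<And>P. B P \<le> C"
  shows "integrable lborel (\<lambda>P. gauss_ft e (P0 - P) * B P)"
    and "integrable lborel (\<lambda>y. gauss_ft 1 y * B (P0 + sqrt e *\<^sub>R y))"
    and "(LINT P|lborel. gauss_ft e (P0 - P) * B P) = (LINT y|lborel. gauss_ft 1 y * B (P0 + sqrt e *\<^sub>R y))"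
proof -
  define c where "c = sqrt e"
  have c: "c > 0" "c\<^sup>2 = e" "sqrt e = c" using e by (simp_all add: c_def)
  let ?f = "\<lambda>P. gauss_ft e (P0 - P) * B P"
  let ?g = "\<lambda>y. gauss_ft 1 y * B (P0 + c *\<^sub>R y)"
  have eq: "c ^ DIM('b) * ?f (P0 + c *\<^sub>R y) = ?g y" for y
  proof -
    have "c ^ DIM('b) * (sqrt (2 * pi / e)) ^ DIM('b) = (sqrt (2 * pi)) ^ DIM('b)"
      using c by (simp add: power_mult_distrib[symmetric] real_sqrt_divide)
    moreover have "(norm (P0 - (P0 + c *\<^sub>R y)))\<^sup>2 / (2 * e) = (norm y)\<^sup>2 / 2"
      using c(1) by (simp add: power_mult_distrib c(2)[symmetric])
    ultimately show ?thesis by (simp add: gauss_ft_def mult.assoc[symmetric])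
  qed
  have lb: "(lborel :: 'b measure) = density (distr lborel borel (\<lambda>y. P0 + c *\<^sub>R y)) (\<lambda>_. c ^ DIM('b))"
    by (rule lborel_affine[of c P0, unfolded abs_of_pos[OF c(1)]]) (use c(1) in auto)
  have g: "integrable lborel ?g"
  proof (rule Bochner_Integration.integrable_bound)
    show "integrable lborel (\<lambda>y::'b. C * gauss_ft 1 y)" using integral_std_gauss(1)[where 'b = 'b] by simp
    show "AE y in lborel. norm (?g y) \<le> norm (C * gauss_ft 1 y)"
    proof (rule AE_I2)
      fix y
      have "gauss_ft 1 y * B (P0 + c *\<^sub>R y) \<le> gauss_ft 1 y * C" using B by (intro mult_left_mono) auto
      moreover have "C \<ge> 0" using B[of P0] by linarith
      ultimately show "norm (?g y) \<le> norm (C * gauss_ft 1 y)"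
        using B(1)[of "P0 + c *\<^sub>R y"] by (simp add: abs_mult mult.commute[of C])
    qed
  qed measurable
  have "integrable (density (distr lborel borel (\<lambda>y. P0 + c *\<^sub>R y)) (\<lambda>_. c ^ DIM('b))) ?f"
  proof (subst integrable_density)
    have "integrable lborel (\<lambda>y. c ^ DIM('b) *\<^sub>R ?f (P0 + c *\<^sub>R y))"
      using g by (simp only: real_scaleR_def eq)
    then show "integrable (distr lborel borel (\<lambda>y. P0 + c *\<^sub>R y)) (\<lambda>P. c ^ DIM('b) *\<^sub>R ?f P)"
      by (rule integrable_distr_eq[THEN iffD2, rotated 2]) measurable
  qed (use c in auto)
  then show "integrable lborel ?f" by (simp only: lb[symmetric])
  show "integrable lborel (\<lambda>y. gauss_ft 1 y * B (P0 + sqrt e *\<^sub>R y))" using g by (simp only: c(3))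
  have "integral\<^sup>L lborel ?f = integral\<^sup>L (density (distr lborel borel (\<lambda>y. P0 + c *\<^sub>R y)) (\<lambda>_. c ^ DIM('b))) ?f"
    by (simp only: lb[symmetric])
  also have "\<dots> = (LINT y|lborel. c ^ DIM('b) * ?f (P0 + c *\<^sub>R y))"
    using c by (subst integral_density) (auto simp: integral_distr)
  also have "\<dots> = (LINT y|lborel. ?g y)" unfolding eq ..
  finally show "integral\<^sup>L lborel ?f = (LINT y|lborel. gauss_ft 1 y * B (P0 + sqrt e *\<^sub>R y))" by (simp only: c(3))
qed

lemma gauss_convolution_bound:
  fixes B :: "'b::euclidean_space \<Rightarrow> real"
  assumes e: "e > 0" and [measurable]: "B \<in> borel_measurable borel"
    and B: "\<And>P. 0 \<le> B P" "\<And>P. B P \<le> C"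
  shows "0 \<le> (LINT P|lborel. gauss_ft e (P0 - P) * B P)"
    and "(LINT P|lborel. gauss_ft e (P0 - P) * B P) \<le> (2 * pi) ^ DIM('b) * C"
proof -
  show "0 \<le> (LINT P|lborel. gauss_ft e (P0 - P) * B P)" using e B by (intro integral_nonneg_AE) auto
  have "(LINT y|lborel. gauss_ft 1 y * B (P0 + sqrt e *\<^sub>R y)) \<le> (LINT y|lborel. gauss_ft 1 (y::'b) * C)"
    using B integral_std_gauss(1)[where 'b = 'b] by (intro integral_mono gauss_convolution_scale(2)[OF assms]) (auto intro!: mult_left_mono)
  then show "(LINT P|lborel. gauss_ft e (P0 - P) * B P) \<le> (2 * pi) ^ DIM('b) * C"
    unfolding gauss_convolution_scale(3)[OF assms] by (simp add: integral_std_gauss)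
qed

text \<open>Continuity is asked for at the single point \<open>P0\<close>, because the intended
  \<open>B\<close> contains the pair density, which may jump at the energy threshold.\<close>

lemma gauss_convolution_tendsto:
  fixes B :: "'b::euclidean_space \<Rightarrow> real"
  assumes [measurable]: "B \<in> borel_measurable borel"
    and B: "\<And>P. 0 \<le> B P" "\<And>P. B P \<le> C" and cont: "isCont B P0"
    and e: "\<And>n. e n > 0" "e \<longlonglongrightarrow> 0"
  shows "(\<lambda>n. LINT P|lborel. gauss_ft (e n) (P0 - P) * B P) \<longlonglongrightarrow> (2 * pi) ^ DIM('b) * B P0"
proof -
  have "(\<lambda>n. LINT y|lborel. gauss_ft 1 y * B (P0 + sqrt (e n) *\<^sub>R y)) \<longlonglongrightarrow> (LINT y|lborel. gauss_ft 1 (y::'b) * B P0)"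
  proof (rule integral_dominated_convergence[where w = "\<lambda>y. gauss_ft 1 y * C"])
    show "AE y in lborel. (\<lambda>n. gauss_ft 1 y * B (P0 + sqrt (e n) *\<^sub>R y)) \<longlonglongrightarrow> gauss_ft 1 y * B P0"
    proof (rule AE_I2, rule tendsto_mult_left, rule isCont_tendsto_compose[OF cont])
      fix y :: 'b
      have "(\<lambda>n. P0 + sqrt (e n) *\<^sub>R y) \<longlonglongrightarrow> P0 + sqrt 0 *\<^sub>R y"
        using e(2) by (intro tendsto_add tendsto_const tendsto_scaleR tendsto_real_sqrt)
      then show "(\<lambda>n. P0 + sqrt (e n) *\<^sub>R y) \<longlonglongrightarrow> P0" by simp
    qed
    show "AE y in lborel. norm (gauss_ft 1 y * B (P0 + sqrt (e n) *\<^sub>R y)) \<le> gauss_ft 1 y * C" for n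
      using B by (auto simp: abs_mult intro!: mult_left_mono)
  qed (use integral_std_gauss(1)[where 'b = 'b] in auto)
  then show ?thesis
    unfolding gauss_convolution_scale(3)[OF e(1) assms(1) B] by (simp add: integral_std_gauss)
qed

section \<open>Parseval's identity with Gaussian damping\<close>

lemma lborel_pair_product:
  fixes f :: "'a::euclidean_space \<Rightarrow> 'c::{real_normed_field, banach, second_countable_topology}"
    and g :: "'b::euclidean_space \<Rightarrow> 'c"
  assumes f: "integrable lborel f" and g: "integrable lborel g"
  shows "integrable lborel (\<lambda>z. f (fst z) * g (snd z))"
    and "(LINT z|lborel. f (fst z) * g (snd z)) = (LINT x|lborel. f x) * (LINT y|lborel. g y)"
proof -
  have [measurable]: "f \<in> borel_measurable lborel" "g \<in> borel_measurable lborel" using f g by auto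
  have "integrable (lborel \<Otimes>\<^sub>M lborel) (\<lambda>z. f (fst z) * g (snd z))"
  proof (rule lborel_pair.Fubini_integrable)
    show "integrable lborel (\<lambda>x. LINT y|lborel. norm (f (fst (x, y)) * g (snd (x, y))))"
      using integrable_norm[OF f] by (simp add: norm_mult)
    show "AE x in lborel. integrable lborel (\<lambda>y. f (fst (x, y)) * g (snd (x, y)))"
      using g by simp
  qed measurable
  then show int: "integrable lborel (\<lambda>z. f (fst z) * g (snd z))" by (simp only: lborel_prod)
  have "(LINT z|lborel. f (fst z) * g (snd z)) = (LINT z|(lborel \<Otimes>\<^sub>M lborel). f (fst z) * g (snd z))"
    by (simp only: lborel_prod)
  also have "\<dots> = (LINT x|lborel. LINT y|lborel. f (fst (x, y)) * g (snd (x, y)))"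
    using lborel_pair.integral_fst'[of "\<lambda>z. f (fst z) * g (snd z)"] int by (simp add: lborel_prod)
  also have "\<dots> = (LINT x|lborel. f x) * (LINT y|lborel. g y)" by simp
  finally show "(LINT z|lborel. f (fst z) * g (snd z)) = (LINT x|lborel. f x) * (LINT y|lborel. g y)" .
qed

lemma integrable_cis_mult:
  assumes "integrable M g" and [measurable]: "h \<in> borel_measurable M"
  shows "integrable M (\<lambda>z. cis (h z) * g z)"
proof (rule Bochner_Integration.integrable_bound[OF assms(1)])
  have [measurable]: "g \<in> borel_measurable M" using assms by auto
  have [measurable]: "cis \<in> borel_measurable borel"
    unfolding cis_conv_exp[abs_def] by (intro borel_measurable_continuous_onI continuous_intros)
  show "(\<lambda>z. cis (h z) * g z) \<in> borel_measurable M" by measurable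
qed (simp add: norm_mult)

text \<open>The squared modulus is a double integral with phase
  \<open>q \<bullet> (S z - S z')\<close>; integrating the Gaussian over \<open>q\<close> first
  replaces the phase by \<open>gauss_ft\<close>. As \<open>S\<close> is any Borel map, the
  push-forward of \<open>g\<close> under \<open>S\<close> never has to possess a density. Positivity
  of the right-hand side is inherited from the left.\<close>

lemma gauss_parseval:
  fixes g :: "'c::euclidean_space \<Rightarrow> complex" and S :: "'c \<Rightarrow> 'b::euclidean_space"
  assumes g: "integrable lborel g" and [measurable]: "S \<in> borel_measurable borel" and e: "e > 0"
  defines "k \<equiv> \<lambda>z. g (fst z) * cnj (g (snd z)) * complex_of_real (gauss_ft e (S (fst z) - S (snd z)))"
  shows "integrable lborel k"
    and "(\<integral>\<^sup>+q. ennreal ((cmod (LINT z|lborel. cis (q \<bullet> S z) * g z))\<^sup>2 * exp (- e * (norm q)\<^sup>2 / 2)) \<partial>lborel)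
       = ennreal (Re (LINT z|lborel. k z))"
    and "0 \<le> Re (LINT z|lborel. k z)"
proof -
  have gm[measurable]: "g \<in> borel_measurable lborel" using g by auto
  have [measurable]: "cis \<in> borel_measurable borel"
    unfolding cis_conv_exp[abs_def] by (intro borel_measurable_continuous_onI continuous_intros)
  define E where "E q = complex_of_real (exp (- e * (norm q)\<^sup>2 / 2))" for q :: 'b
  have [measurable]: "E \<in> borel_measurable borel"
    unfolding E_def by (intro borel_measurable_continuous_onI continuous_intros) auto
  define I where "I q = (LINT z|lborel. cis (q \<bullet> S z) * g z)" for q
  have gc: "integrable lborel (\<lambda>z. cnj (g z))" using g by simp
  have gg: "integrable lborel (\<lambda>z. g (fst z) * cnj (g (snd z)))"
    by (rule lborel_pair_product(1)[OF g gc])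
  have [measurable]: "(\<lambda>z. g (fst z) * cnj (g (snd z))) \<in> borel_measurable lborel"
    using gg by auto
  define T where "T z = S (fst z) - S (snd z)" for z :: "'c \<times> 'c"
  have T[measurable]: "T \<in> borel_measurable borel"
  proof -
    have "T \<in> borel_measurable (borel \<Otimes>\<^sub>M borel)" unfolding T_def[abs_def] by measurable
    then show ?thesis by (simp add: borel_prod)
  qed
  have Isq: "complex_of_real ((cmod (I q))\<^sup>2) = (LINT z|lborel. cis (q \<bullet> T z) * (g (fst z) * cnj (g (snd z))))" for q
  proof -
    have i: "integrable lborel (\<lambda>z. cis (q \<bullet> S z) * g z)"
      by (rule integrable_cis_mult[OF g]) measurable
    have "complex_of_real ((cmod (I q))\<^sup>2) = I q * cnj (I q)" by (rule complex_norm_square)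
    also have "cnj (I q) = (LINT z|lborel. cnj (cis (q \<bullet> S z) * g z))" unfolding I_def by (rule Bochner_Integration.integral_cnj[symmetric])
    also have "I q * \<dots> = (LINT z|lborel. (cis (q \<bullet> S (fst z)) * g (fst z)) * cnj (cis (q \<bullet> S (snd z)) * g (snd z)))"
      unfolding I_def by (rule lborel_pair_product(2)[OF i Bochner_Integration.integrable_cnj[OF i], symmetric])
    also have "\<dots> = (LINT z|lborel. cis (q \<bullet> T z) * (g (fst z) * cnj (g (snd z))))"
      by (intro Bochner_Integration.integral_cong refl)
         (simp add: T_def inner_diff_right cis_divide[symmetric] cis_cnj cis_inverse divide_inverse mult_ac)
    finally show ?thesis .
  qed
  have Eint: "integrable lborel E"
    using gauss_fourier(1)[OF e, of "0::'b"] unfolding E_def by simp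
  \<comment> \<open>The phase has modulus 1 and what remains is a product of integrable functions of
    separate variables; this licenses Fubini in both orders.\<close>
  have dbl: "integrable lborel (\<lambda>w. cis (fst w \<bullet> T (snd w)) * (E (fst w) * (g (fst (snd w)) * cnj (g (snd (snd w))))))"
  proof (rule integrable_cis_mult)
    show "integrable lborel (\<lambda>w. E (fst w) * (g (fst (snd w)) * cnj (g (snd (snd w)))))"
      by (rule lborel_pair_product(1)[OF Eint gg])
    have "(\<lambda>w. fst w \<bullet> T (snd w)) \<in> borel_measurable (borel \<Otimes>\<^sub>M borel)" by measurable
    then show "(\<lambda>w. fst w \<bullet> T (snd w)) \<in> borel_measurable lborel" by (simp add: borel_prod)
  qed
  let ?D = "\<lambda>q z. cis (q \<bullet> T z) * (E q * (g (fst z) * cnj (g (snd z))))"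
  have dbl': "integrable (lborel \<Otimes>\<^sub>M lborel) (case_prod ?D)"
    using dbl unfolding lborel_prod case_prod_beta' .
  have inner: "(LINT q|lborel. ?D q z) = k z" for z
  proof -
    have "(LINT q|lborel. ?D q z) = (LINT q|lborel. g (fst z) * cnj (g (snd z)) * (cis (q \<bullet> T z) * E q))"
      by (simp add: mult_ac)
    also have "\<dots> = g (fst z) * cnj (g (snd z)) * (LINT q|lborel. cis (q \<bullet> T z) * E q)"
      by (rule Bochner_Integration.integral_mult_right_zero)
    also have "\<dots> = k z" using gauss_fourier(2)[OF e, of "T z"] by (simp add: E_def k_def T_def)
    finally show ?thesis .
  qed
  have "integrable lborel (\<lambda>z. LINT q|lborel. ?D q z)"
    by (rule lborel_pair.integrable_snd[OF dbl'])
  then show "integrable lborel k" unfolding inner .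
  have outer: "(LINT z|lborel. ?D q z) = complex_of_real ((cmod (I q))\<^sup>2 * exp (- e * (norm q)\<^sup>2 / 2))" for q
  proof -
    have "(LINT z|lborel. ?D q z) = (LINT z|lborel. E q * (cis (q \<bullet> T z) * (g (fst z) * cnj (g (snd z)))))"
      by (simp add: mult_ac)
    also have "\<dots> = E q * (LINT z|lborel. cis (q \<bullet> T z) * (g (fst z) * cnj (g (snd z))))"
      by (rule Bochner_Integration.integral_mult_right_zero)
    finally show ?thesis unfolding Isq[symmetric] by (simp add: E_def mult.commute)
  qed
  have "integrable lborel (\<lambda>q. LINT z|lborel. ?D q z)"
    by (rule lborel_pair.integrable_fst[OF dbl'])
  then have i1: "integrable lborel (\<lambda>q. (cmod (I q))\<^sup>2 * exp (- e * (norm q)\<^sup>2 / 2))"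
    unfolding outer by (simp only: complex_of_real_integrable_eq)
  have "(LINT q|lborel. LINT z|lborel. ?D q z) = (LINT z|lborel. LINT q|lborel. ?D q z)"
    by (rule lborel_pair.Fubini_integral[OF dbl', symmetric])
  then have "complex_of_real (LINT q|lborel. (cmod (I q))\<^sup>2 * exp (- e * (norm q)\<^sup>2 / 2)) = (LINT z|lborel. k z)"
    unfolding inner outer integral_complex_of_real .
  then have re: "(LINT q|lborel. (cmod (I q))\<^sup>2 * exp (- e * (norm q)\<^sup>2 / 2)) = Re (LINT z|lborel. k z)"
    by (metis Re_complex_of_real)
  show "0 \<le> Re (LINT z|lborel. k z)"
    unfolding re[symmetric] by (intro integral_nonneg_AE) auto
  have "(\<integral>\<^sup>+q. ennreal ((cmod (I q))\<^sup>2 * exp (- e * (norm q)\<^sup>2 / 2)) \<partial>lborel)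
      = ennreal (LINT q|lborel. (cmod (I q))\<^sup>2 * exp (- e * (norm q)\<^sup>2 / 2))"
    by (rule nn_integral_eq_integral[OF i1]) simp
  then show "(\<integral>\<^sup>+q. ennreal ((cmod (LINT z|lborel. cis (q \<bullet> S z) * g z))\<^sup>2 * exp (- e * (norm q)\<^sup>2 / 2)) \<partial>lborel)
       = ennreal (Re (LINT z|lborel. k z))"
    unfolding re by (simp add: I_def)
qed

section \<open>Integration along lines and radial integration\<close>

lemma nn_integral_lborel_translate:
  fixes g :: "'a::euclidean_space \<Rightarrow> ennreal"
  assumes [measurable]: "g \<in> borel_measurable borel"
  shows "(\<integral>\<^sup>+x. g (c + x) \<partial>lborel) = (\<integral>\<^sup>+x. g x \<partial>lborel)"
  by (subst (2) lborel_distr_plus[of c, symmetric]) (simp add: nn_integral_distr)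

lemma nn_integral_lborel_pair:
  fixes g :: "'a::euclidean_space \<times> 'b::euclidean_space \<Rightarrow> ennreal"
  assumes [measurable]: "g \<in> borel_measurable (borel \<Otimes>\<^sub>M borel)"
  shows "(\<integral>\<^sup>+z. g z \<partial>lborel) = (\<integral>\<^sup>+x. \<integral>\<^sup>+y. g (x, y) \<partial>lborel \<partial>lborel)"
proof -
  have "g \<in> borel_measurable (lborel \<Otimes>\<^sub>M lborel)" by measurable
  then show ?thesis using lborel.nn_integral_fst[of g lborel] by (simp add: lborel_prod)
qed

text \<open>Monotone convergence extends the substitution rule from compact intervals to their
  increasing union, in order to cover the whole line and the half-line.\<close>

lemma nn_integral_substitution_Union:
  fixes f g g' :: "real \<Rightarrow> real" and a b :: "nat \<Rightarrow> real"
  assumes [measurable]: "f \<in> borel_measurable borel"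
    and der: "\<And>x. (g has_real_derivative g' x) (at x)"
    and cont: "continuous_on UNIV g'"
    and nonneg: "\<And>n x. x \<in> {a n..b n} \<Longrightarrow> g' x \<ge> 0"
    and ab: "\<And>n. a n \<le> b n" "decseq a" "incseq b"
  shows "(\<integral>\<^sup>+x. ennreal (f x) * indicator (\<Union>n. {g (a n)..g (b n)}) x \<partial>lborel)
       = (\<integral>\<^sup>+x. ennreal (f (g x) * g' x) * indicator (\<Union>n. {a n..b n}) x \<partial>lborel)"
proof -
  have [measurable]: "g \<in> borel_measurable borel" "g' \<in> borel_measurable borel"
    using der cont by (auto intro!: borel_measurable_continuous_onI DERIV_continuous_on)
  have mono: "g x \<le> g y" if "a n \<le> x" "x \<le> y" "y \<le> b n" for n x y
    by (rule DERIV_nonneg_imp_nondecreasing[OF that(2)])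
       (use der nonneg[of _ n] that in \<open>meson atLeastAtMost_iff order_trans\<close>)
  have inc1: "incseq (\<lambda>n. {a n..b n})"
    using ab by (fastforce simp: incseq_def decseq_def)
  have inc2: "incseq (\<lambda>n. {g (a n)..g (b n)})"
  proof (rule incseq_SucI)
    fix n
    have "a (Suc n) \<le> a n" "b n \<le> b (Suc n)" using ab by (auto simp: incseq_SucD decseq_SucD)
    then have "g (a (Suc n)) \<le> g (a n)" "g (b n) \<le> g (b (Suc n))"
      using mono[of "Suc n" "a (Suc n)" "a n"] mono[of "Suc n" "b n" "b (Suc n)"] ab(1)[of n] by auto
    then show "{g (a n)..g (b n)} \<le> {g (a (Suc n))..g (b (Suc n))}" by auto
  qed
  have "(\<integral>\<^sup>+x. ennreal (f x) * indicator (\<Union>n. {g (a n)..g (b n)}) x \<partial>lborel)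
      = emeasure (density lborel (\<lambda>x. ennreal (f x))) (\<Union>n. {g (a n)..g (b n)})"
    by (subst emeasure_density) auto
  also have "\<dots> = (SUP n. emeasure (density lborel (\<lambda>x. ennreal (f x))) {g (a n)..g (b n)})"
    by (rule SUP_emeasure_incseq[symmetric]) (auto simp: inc2)
  also have "\<dots> = (SUP n. \<integral>\<^sup>+x. ennreal (f x * indicator {g (a n)..g (b n)} x) \<partial>lborel)"
    by (subst emeasure_density) (auto simp: indicator_def intro!: SUP_cong nn_integral_cong)
  also have "\<dots> = (SUP n. \<integral>\<^sup>+x. ennreal (f (g x) * g' x * indicator {a n..b n} x) \<partial>lborel)"
    using der cont nonneg ab(1)
    by (intro SUP_cong refl nn_integral_substitution)
       (auto intro: continuous_on_subset simp: set_borel_measurable_def)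
  also have "\<dots> = (SUP n. emeasure (density lborel (\<lambda>x. ennreal (f (g x) * g' x))) {a n..b n})"
    by (subst emeasure_density) (auto simp: indicator_def intro!: SUP_cong nn_integral_cong)
  also have "\<dots> = emeasure (density lborel (\<lambda>x. ennreal (f (g x) * g' x))) (\<Union>n. {a n..b n})"
    by (rule SUP_emeasure_incseq) (auto simp: inc1)
  also have "\<dots> = (\<integral>\<^sup>+x. ennreal (f (g x) * g' x) * indicator (\<Union>n. {a n..b n}) x \<partial>lborel)"
    by (subst emeasure_density) auto
  finally show ?thesis .
qed

text \<open>Averaging over translates along a unit vector reduces integration over the whole space
  to integration along parallel lines, so a substitution along one direction needs neither a
  rotation of coordinates nor a Jacobian determinant.\<close>

lemma nn_integral_average_lines:
  fixes g :: "'a::euclidean_space \<Rightarrow> ennreal"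
  assumes [measurable]: "g \<in> borel_measurable borel" and e: "norm e = 1"
  shows "(\<integral>\<^sup>+x. g x \<partial>lborel)
       = (\<integral>\<^sup>+x. indicator {0..1} (x \<bullet> e) * (\<integral>\<^sup>+s. g (x + s *\<^sub>R e) \<partial>lborel) \<partial>lborel)"
proof -
  have ee: "e \<bullet> e = 1" using e by (simp add: norm_eq_1)
  have "(\<integral>\<^sup>+x. indicator {0..1} (x \<bullet> e) * (\<integral>\<^sup>+s. g (x + s *\<^sub>R e) \<partial>lborel) \<partial>lborel)
      = (\<integral>\<^sup>+x. \<integral>\<^sup>+s. indicator {0..1} (x \<bullet> e) * g (x + s *\<^sub>R e) \<partial>(lborel::real measure) \<partial>lborel)"
    by (simp add: nn_integral_cmult)
  also have "\<dots> = (\<integral>\<^sup>+s. \<integral>\<^sup>+x. indicator {0..1} (x \<bullet> e) * g (x + s *\<^sub>R e) \<partial>lborel \<partial>(lborel::real measure))"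
    by (rule lborel_pair.Fubini'[symmetric]) measurable
  also have "\<dots> = (\<integral>\<^sup>+s. \<integral>\<^sup>+x. indicator {0..1} (x \<bullet> e - s) * g x \<partial>lborel \<partial>(lborel::real measure))"
  proof (rule nn_integral_cong)
    fix s :: real
    have "(\<integral>\<^sup>+x. indicator {0..1} (x \<bullet> e) * g (x + s *\<^sub>R e) \<partial>lborel)
        = (\<integral>\<^sup>+x. indicator {0..1} ((s *\<^sub>R e + x) \<bullet> e - s) * g (s *\<^sub>R e + x) \<partial>lborel)"
      by (simp add: inner_add_left ee add.commute)
    also have "\<dots> = (\<integral>\<^sup>+x. indicator {0..1} (x \<bullet> e - s) * g x \<partial>lborel)"
      by (rule nn_integral_lborel_translate) measurable
    finally show "(\<integral>\<^sup>+x. indicator {0..1} (x \<bullet> e) * g (x + s *\<^sub>R e) \<partial>lborel) = \<dots>" .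
  qed
  also have "\<dots> = (\<integral>\<^sup>+x. \<integral>\<^sup>+s. indicator {0..1} (x \<bullet> e - s) * g x \<partial>(lborel::real measure) \<partial>lborel)"
    by (rule lborel_pair.Fubini') measurable
  also have "\<dots> = (\<integral>\<^sup>+x. g x \<partial>lborel)"
  proof (rule nn_integral_cong)
    fix x :: 'a
    have "(\<integral>\<^sup>+s. indicator {0..1} (x \<bullet> e - s) * g x \<partial>(lborel::real measure))
        = (\<integral>\<^sup>+s. indicator {x \<bullet> e - 1..x \<bullet> e} s \<partial>lborel) * g x"
      by (subst nn_integral_multc[symmetric]) (auto simp: indicator_def intro!: nn_integral_cong)
    also have "\<dots> = g x" by simp
    finally show "(\<integral>\<^sup>+s. indicator {0..1} (x \<bullet> e - s) * g x \<partial>(lborel::real measure)) = g x" .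
  qed
  finally show ?thesis ..
qed

text \<open>Each line in direction \<open>e\<close> passes through a point orthogonal to
  \<open>e\<close>, and translation invariance lets the parameter start there. Two functions with
  equal integrals along all these lines then have equal integrals over the space.\<close>

lemma nn_integral_cong_lines:
  fixes g h :: "'a::euclidean_space \<Rightarrow> ennreal"
  assumes g: "g \<in> borel_measurable borel" and h: "h \<in> borel_measurable borel" and e: "norm e = 1"
    and eq: "\<And>p. p \<bullet> e = 0 \<Longrightarrow>
      (\<integral>\<^sup>+s. g (p + s *\<^sub>R e) \<partial>lborel) = (\<integral>\<^sup>+s. h (p + s *\<^sub>R e) \<partial>lborel)"
  shows "(\<integral>\<^sup>+x. g x \<partial>lborel) = (\<integral>\<^sup>+x. h x \<partial>lborel)"
proof -
  have "(\<integral>\<^sup>+s. g (x + s *\<^sub>R e) \<partial>lborel) = (\<integral>\<^sup>+s. h (x + s *\<^sub>R e) \<partial>lborel)" for x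
  proof -
    define p where "p = x - (x \<bullet> e) *\<^sub>R e"
    have p: "p \<bullet> e = 0" using e by (simp add: p_def inner_diff_left norm_eq_1)
    have shift: "(\<integral>\<^sup>+s. k (x + s *\<^sub>R e) \<partial>lborel) = (\<integral>\<^sup>+s. k (p + s *\<^sub>R e) \<partial>lborel)"
      if [measurable]: "k \<in> borel_measurable borel" for k :: "'a \<Rightarrow> ennreal"
      using nn_integral_lborel_translate[of "\<lambda>s. k (p + s *\<^sub>R e)" "x \<bullet> e"]
      by (simp add: p_def algebra_simps)
    show ?thesis by (simp add: shift g h eq[OF p])
  qed
  then show ?thesis
    using nn_integral_average_lines[OF g e] nn_integral_average_lines[OF h e] by simp
qed

lemma sphere_area_eq:
  assumes "d > 0"
  shows "sphere_area d = real d * unit_ball_vol (real d)"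
proof -
  have "Gamma (real d / 2 + 1) = real d / 2 * Gamma (real d / 2)"
    using assms by (intro Gamma_plus1) (auto simp: nonpos_Ints_def)
  note G = this
  show ?thesis
    unfolding sphere_area_def unit_ball_vol_def G using assms by simp
qed

text \<open>The distribution of the norm is read off from volumes of balls. The sign is reversed
  because measures on the line are compared on the sets \<open>{x<..}\<close>: under
  \<open>- norm\<close> these correspond to balls, of finite volume, and not to their
  complements.\<close>

lemma nn_integral_radial:
  fixes h :: "real \<Rightarrow> ennreal"
  assumes [measurable]: "h \<in> borel_measurable borel"
  shows "(\<integral>\<^sup>+x. h (norm (x::'a::euclidean_space)) \<partial>lborel)
       = (\<integral>\<^sup>+r. ennreal (sphere_area DIM('a) * r ^ (DIM('a) - 1)) * h r * indicator {0..} r \<partial>lborel)"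
proof -
  define n where "n = DIM('a)"
  have n: "n > 0" by (simp add: n_def)
  define \<rho> where "\<rho> r = ennreal (sphere_area n * (- r) ^ (n - 1)) * indicator {..0} r" for r :: real
  have [measurable]: "\<rho> \<in> borel_measurable borel" unfolding \<rho>_def by measurable
  have sa: "sphere_area n \<ge> 0" using n by (simp add: sphere_area_eq)
  have em: "emeasure (distr lborel borel (\<lambda>x::'a. - norm x)) {x<..}
      = ennreal (unit_ball_vol n * (if x < 0 then (- x) ^ n else 0))" for x
  proof -
    have "emeasure (distr lborel borel (\<lambda>x::'a. - norm x)) {x<..} = emeasure lborel (ball (0::'a) (- x))"
      by (subst emeasure_distr) (auto intro!: arg_cong[where f = "emeasure lborel"])
    also have "\<dots> = ennreal (unit_ball_vol n * (if x < 0 then (- x) ^ n else 0))"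
      using emeasure_ball[of "- x" "0::'a"] by (cases "x < 0") (auto simp: n_def ball_empty)
    finally show ?thesis .
  qed
  have "distr lborel borel (\<lambda>x::'a. - norm x) = density lborel \<rho>"
  proof (rule measure_eqI_lessThan)
    fix x :: real
    show "emeasure (distr lborel borel (\<lambda>x::'a. - norm x)) {x<..} < \<infinity>"
      unfolding em by simp
    show "emeasure (distr lborel borel (\<lambda>x::'a. - norm x)) {x<..} = emeasure (density lborel \<rho>) {x<..}"
    proof (cases "x < 0")
      case True
      have "emeasure (density lborel \<rho>) {x<..} = (\<integral>\<^sup>+r. \<rho> r * indicator {x<..} r \<partial>lborel)"
        by (subst emeasure_density) auto
      also have "\<dots> = (\<integral>\<^sup>+r. ennreal (sphere_area n * (- r) ^ (n - 1)) * indicator {x..0} r \<partial>lborel)"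
        by (intro nn_integral_cong_AE, rule AE_mp[OF AE_lborel_singleton[of x]], rule AE_I2)
           (auto simp: \<rho>_def indicator_def)
      also have "\<dots> = ennreal ((- unit_ball_vol n * (- 0) ^ n) - (- unit_ball_vol n * (- x) ^ n))"
      proof (rule nn_integral_FTC_Icc)
        fix r assume r: "r \<in> {x..0}"
        show "((\<lambda>r. - unit_ball_vol n * (- r) ^ n) has_real_derivative sphere_area n * (- r) ^ (n - 1)) (at r)"
          using n by (auto intro!: derivative_eq_intros simp: sphere_area_eq)
        show "0 \<le> sphere_area n * (- r) ^ (n - 1)" using r sa by simp
      qed (use True in auto)
      finally show ?thesis using True n by (simp add: em)
    next
      case False
      have "emeasure (density lborel \<rho>) {x<..} = (\<integral>\<^sup>+r. \<rho> r * indicator {x<..} r \<partial>lborel)"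
        by (subst emeasure_density) auto
      also have "\<dots> = (\<integral>\<^sup>+r. 0 \<partial>(lborel :: real measure))"
        using False by (intro nn_integral_cong) (auto simp: \<rho>_def indicator_def)
      finally show ?thesis using False by (simp add: em)
    qed
  qed auto
  then have "(\<integral>\<^sup>+r. h (- r) \<partial>distr lborel borel (\<lambda>x::'a. - norm x)) = (\<integral>\<^sup>+r. h (- r) \<partial>density lborel \<rho>)"
    by simp
  then have "(\<integral>\<^sup>+x. h (norm (x::'a)) \<partial>lborel) = (\<integral>\<^sup>+r. \<rho> r * h (- r) \<partial>lborel)"
    by (simp add: nn_integral_distr nn_integral_density)
  also have "\<dots> = (\<integral>\<^sup>+r. \<rho> (- r) * h r \<partial>lborel)"
    by (subst lborel_distr_uminus[symmetric], subst nn_integral_distr) simp_all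
  also have "\<dots> = (\<integral>\<^sup>+r. ennreal (sphere_area n * r ^ (n - 1)) * h r * indicator {0..} r \<partial>lborel)"
    by (intro nn_integral_cong) (auto simp: \<rho>_def indicator_def)
  finally show ?thesis by (simp add: n_def)
qed

section \<open>Pairs of given total energy and momentum\<close>

abbreviation (input) phi :: "'a::euclidean_space \<Rightarrow> real" where
  "phi x \<equiv> KG_phi (norm x)"

lemma phi_sq: "(phi x)\<^sup>2 = 1 + (norm x)\<^sup>2"
  by (simp add: KG_phi_def)

lemma phi_ge_1: "phi x \<ge> 1"
  by (simp add: KG_phi_def)

lemma KG_phi_nonneg [simp]: "KG_phi r \<ge> 0"
  by (simp add: KG_phi_def)

lemma KG_phi_pos [simp]: "KG_phi r > 0"
  by (simp add: KG_phi_def add_pos_nonneg)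

lemma continuous_on_KG_phi [continuous_intros]:
  "continuous_on S f \<Longrightarrow> continuous_on S (\<lambda>x. KG_phi (f x))"
  unfolding KG_phi_def by (intro continuous_intros)

lemma borel_measurable_KG_phi [measurable]: "KG_phi \<in> borel_measurable borel"
  by (intro borel_measurable_continuous_onI continuous_intros)

text \<open>Energy and momentum of a pair of particles with total momentum \<open>\<eta>\<close>. In the rest frame the
  two particles have momenta \<open>z\<close> and \<open>- z\<close>; the Lorentz boost to the laboratory frame only
  changes the component of \<open>z\<close> along \<open>\<eta>\<close>.\<close>

lemma KG_pair_line:
  fixes p e :: "'a::euclidean_space" and H :: "real \<Rightarrow> real"
  assumes [measurable]: "H \<in> borel_measurable borel"
    and e: "norm e = 1" and pe: "p \<bullet> e = 0" and L: "L \<ge> 0"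
  defines "\<eta> \<equiv> L *\<^sub>R e"
  shows "(\<integral>\<^sup>+s. ennreal (H (phi (\<eta> /\<^sub>R 2 + (p + s *\<^sub>R e)) + phi (\<eta> /\<^sub>R 2 - (p + s *\<^sub>R e)))
            / (phi (\<eta> /\<^sub>R 2 + (p + s *\<^sub>R e)) * phi (\<eta> /\<^sub>R 2 - (p + s *\<^sub>R e)))) \<partial>lborel)
       = (\<integral>\<^sup>+s. ennreal (H (sqrt (4 * (phi (p + s *\<^sub>R e))\<^sup>2 + L\<^sup>2))
            * (2 / (phi (p + s *\<^sub>R e) * sqrt (4 * (phi (p + s *\<^sub>R e))\<^sup>2 + L\<^sup>2)))) \<partial>lborel)"
proof -
  define Q where "Q = 1 + (norm p)\<^sup>2"
  have Q: "Q \<ge> 1" by (simp add: Q_def)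
  have nrm: "(norm (p + s *\<^sub>R e))\<^sup>2 = (norm p)\<^sup>2 + s\<^sup>2" "(norm (s *\<^sub>R e - p))\<^sup>2 = (norm p)\<^sup>2 + s\<^sup>2" for s
    using e pe
    by (simp_all add: power2_norm_eq_inner inner_add_left inner_add_right inner_diff_left inner_diff_right
        inner_commute norm_eq_1) (simp_all add: power2_eq_square)
  define n where "n z = sqrt (Q + z\<^sup>2)" for z
  define \<tau> where "\<tau> z = sqrt (4 * (Q + z\<^sup>2) + L\<^sup>2)" for z
  \<comment> \<open>In the rest frame both particles have energy \<open>n z\<close>, so the
    invariant mass is \<open>2 * n z\<close>, the total laboratory energy is
    \<open>\<tau> z\<close>, and the Lorentz factor is their quotient. \<open>A z\<close> is the
    boosted component of the relative momentum; \<open>f1\<close> and \<open>f2\<close> are the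
    laboratory energies.\<close>
  define A where "A z = z * \<tau> z / (2 * n z)" for z
  define f1 where "f1 s = sqrt (Q + (L / 2 + s)\<^sup>2)" for s
  define f2 where "f2 s = sqrt (Q + (L / 2 - s)\<^sup>2)" for s
  have phi_n: "phi (p + z *\<^sub>R e) = n z" for z
    by (simp add: KG_phi_def nrm n_def Q_def add.assoc)
  have phi_1: "phi (\<eta> /\<^sub>R 2 + (p + s *\<^sub>R e)) = f1 s" for s
  proof -
    have eq: "\<eta> /\<^sub>R 2 + (p + s *\<^sub>R e) = p + (L / 2 + s) *\<^sub>R e" by (simp add: \<eta>_def algebra_simps)
    show ?thesis unfolding eq by (simp add: KG_phi_def nrm f1_def Q_def add.assoc)
  qed
  have phi_2: "phi (\<eta> /\<^sub>R 2 - (p + s *\<^sub>R e)) = f2 s" for s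
  proof -
    have eq: "\<eta> /\<^sub>R 2 - (p + s *\<^sub>R e) = (L / 2 - s) *\<^sub>R e - p" by (simp add: \<eta>_def algebra_simps)
    show ?thesis unfolding eq by (simp add: KG_phi_def nrm f2_def Q_def add.assoc)
  qed
  have Qz: "Q + z\<^sup>2 > 0" for z :: real using Q by (simp add: add_pos_nonneg)
  have n: "n z > 0" "(n z)\<^sup>2 = Q + z\<^sup>2" for z using Qz[of z] by (simp_all add: n_def)
  have \<tau>: "\<tau> z > 0" "(\<tau> z)\<^sup>2 = 4 * (Q + z\<^sup>2) + L\<^sup>2" for z
    using Qz[of z] by (simp_all add: \<tau>_def add_pos_nonneg)
  have zn: "\<bar>L * z / n z\<bar> < \<tau> z" for z
  proof (rule power_less_imp_less_base[of _ 2])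
    have "z\<^sup>2 \<le> (n z)\<^sup>2" using n(2)[of z] Q by simp
    then have "L\<^sup>2 * z\<^sup>2 / (n z)\<^sup>2 \<le> L\<^sup>2" using n(1)[of z]
      by (simp add: divide_le_eq mult_left_mono)
    then show "\<bar>L * z / n z\<bar>\<^sup>2 < (\<tau> z)\<^sup>2"
      unfolding \<tau>(2) using Qz[of z] by (simp add: power_divide power_mult_distrib)
  qed (use \<tau>(1)[of z] in simp)
  have zn1: "0 < \<tau> z + L * z / n z" and zn2: "0 < \<tau> z - L * z / n z" for z
    using zn[of z] unfolding abs_less_iff by linarith+
  have A2: "(A z)\<^sup>2 = z\<^sup>2 + (L * z / n z)\<^sup>2 / 4" for z
    using n[of z] by (simp add: A_def power_divide power_mult_distrib \<tau>(2) flip: n(2)) (simp add: field_simps)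
  have LA: "L * A z = \<tau> z * (L * z / n z) / 2" for z
    using n[of z] by (simp add: A_def field_simps)
  have f1: "f1 (A z) = (\<tau> z + L * z / n z) / 2" for z
    unfolding f1_def
  proof (rule real_sqrt_unique)
    show "((\<tau> z + L * z / n z) / 2)\<^sup>2 = Q + (L / 2 + A z)\<^sup>2"
      using A2[of z] LA[of z] \<tau>(2)[of z] by (simp add: power2_sum power_divide)
    show "0 \<le> (\<tau> z + L * z / n z) / 2" using zn1[of z] zn2[of z] by (simp add: less_imp_le)
  qed
  have f2: "f2 (A z) = (\<tau> z - L * z / n z) / 2" for z
    unfolding f2_def
  proof (rule real_sqrt_unique)
    show "((\<tau> z - L * z / n z) / 2)\<^sup>2 = Q + (L / 2 - A z)\<^sup>2"
      using A2[of z] LA[of z] \<tau>(2)[of z] by (simp add: power2_diff power_divide)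
    show "0 \<le> (\<tau> z - L * z / n z) / 2" using zn1[of z] zn2[of z] by (simp add: less_imp_le)
  qed
  have f12: "f1 (A z) * f2 (A z) = ((\<tau> z)\<^sup>2 - (L * z / n z)\<^sup>2) / 4" for z
    unfolding f1 f2 by (simp add: power2_eq_square algebra_simps)
  have pos: "f1 (A z) * f2 (A z) > 0" for z
    unfolding f1 f2 using zn1[of z] zn2[of z] by simp
  \<comment> \<open>The derivative of \<open>A\<close>, written so that the product of the two
    energies cancels the denominator of the integrand.\<close>
  define A' where "A' z = 2 * (f1 (A z) * f2 (A z)) / (\<tau> z * n z)" for z
  have dn: "(n has_real_derivative z / n z) (at z)" for z
    unfolding n_def using Qz[of z] by (auto intro!: derivative_eq_intros simp: divide_simps)
  have d\<tau>: "(\<tau> has_real_derivative 4 * z / \<tau> z) (at z)" for z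
    unfolding \<tau>_def using \<tau>[of z] by (auto intro!: derivative_eq_intros simp: divide_simps \<tau>_def)
  have dA: "(A has_real_derivative A' z) (at z)" for z
  proof -
    have "(A has_real_derivative ((\<tau> z + z * (4 * z / \<tau> z)) * (2 * n z) - z * \<tau> z * (2 * (z / n z))) / (2 * n z * (2 * n z))) (at z)"
      unfolding A_def
    proof (rule DERIV_divide)
      show "((\<lambda>z. z * \<tau> z) has_real_derivative \<tau> z + z * (4 * z / \<tau> z)) (at z)"
        using DERIV_mult[OF DERIV_ident d\<tau>] by (simp add: add.commute mult.commute)
      show "((\<lambda>z. 2 * n z) has_real_derivative 2 * (z / n z)) (at z)"
        by (intro DERIV_cmult dn)
    qed (use n(1)[of z] in simp)
    also have "((\<tau> z + z * (4 * z / \<tau> z)) * (2 * n z) - z * \<tau> z * (2 * (z / n z))) / (2 * n z * (2 * n z))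
        = ((\<tau> z)\<^sup>2 * (n z)\<^sup>2 + 4 * z\<^sup>2 * (n z)\<^sup>2 - z\<^sup>2 * (\<tau> z)\<^sup>2) / (2 * \<tau> z * n z ^ 3)"
      using n(1)[of z] \<tau>(1)[of z] by (simp add: divide_simps) (simp add: power2_eq_square power3_eq_cube algebra_simps)
    also have "(\<tau> z)\<^sup>2 * (n z)\<^sup>2 + 4 * z\<^sup>2 * (n z)\<^sup>2 - z\<^sup>2 * (\<tau> z)\<^sup>2 = (\<tau> z)\<^sup>2 * (n z)\<^sup>2 - (L * z)\<^sup>2"
      by (simp add: \<tau>(2) n(2) algebra_simps power_mult_distrib)
    also have "((\<tau> z)\<^sup>2 * (n z)\<^sup>2 - (L * z)\<^sup>2) / (2 * \<tau> z * n z ^ 3) = A' z"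
      unfolding A'_def f12 using n(1)[of z] \<tau>(1)[of z]
      by (simp add: divide_simps) (simp add: power2_eq_square power3_eq_cube algebra_simps)
    finally show ?thesis .
  qed
  have contn: "continuous_on UNIV n" "continuous_on UNIV \<tau>" "continuous_on UNIV A"
    using DERIV_isCont[OF dn] DERIV_isCont[OF d\<tau>] DERIV_isCont[OF dA]
    by (auto intro!: continuous_at_imp_continuous_on)
  have contA': "continuous_on UNIV A'"
    unfolding A'_def f12 using n(1) \<tau>(1)
    by (intro continuous_intros contn) (auto simp: less_imp_neq[THEN not_sym])
  have [measurable]: "f1 \<in> borel_measurable borel" "f2 \<in> borel_measurable borel"
    unfolding f1_def f2_def by measurable
  have \<tau>n: "\<tau> z \<ge> 2 * n z" for z
    by (rule power2_le_imp_le) (use n[of z] \<tau>[of z] in \<open>auto simp: power_mult_distrib\<close>)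
  \<comment> \<open>The Lorentz factor is at least 1, so the images of the growing intervals exhaust
    the line.\<close>
  have Aup: "A (real k) \<ge> real k" "A (- real k) \<le> - real k" for k
    using \<tau>n[of "real k"] \<tau>n[of "- real k"] n(1)[of "real k"] n(1)[of "- real k"]
    by (auto simp: A_def divide_simps intro!: mult_left_mono)
  have U1: "(\<Union>k. {A (- real k)..A (real k)}) = UNIV"
  proof -
    have "x \<in> {A (- real (nat \<lceil>\<bar>x\<bar>\<rceil>))..A (real (nat \<lceil>\<bar>x\<bar>\<rceil>))}" for x
      using Aup[of "nat \<lceil>\<bar>x\<bar>\<rceil>"] real_nat_ceiling_ge[of "\<bar>x\<bar>"] unfolding atLeastAtMost_iff by linarith
    then show ?thesis by blast
  qed
  have U2: "(\<Union>k. {- real k..real k}) = UNIV"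
  proof -
    have "x \<in> {- real (nat \<lceil>\<bar>x\<bar>\<rceil>)..real (nat \<lceil>\<bar>x\<bar>\<rceil>)}" for x
      using real_nat_ceiling_ge[of "\<bar>x\<bar>"] unfolding atLeastAtMost_iff by linarith
    then show ?thesis by blast
  qed
  have "(\<integral>\<^sup>+s. ennreal (H (f1 s + f2 s) / (f1 s * f2 s)) * indicator (\<Union>k. {A (- real k)..A (real k)}) s \<partial>lborel)
      = (\<integral>\<^sup>+z. ennreal (H (f1 (A z) + f2 (A z)) / (f1 (A z) * f2 (A z)) * A' z) * indicator (\<Union>k. {- real k..real k}) z \<partial>lborel)"
  proof (rule nn_integral_substitution_Union[OF _ dA contA'])
    show "A' z \<ge> 0" for z using pos[of z] n(1)[of z] \<tau>(1)[of z] by (simp add: A'_def)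
  qed (auto simp: decseq_def incseq_def)
  also have "\<dots> = (\<integral>\<^sup>+z. ennreal (H (\<tau> z) * (2 / (n z * \<tau> z))) \<partial>lborel)"
  proof -
    have "H (f1 (A z) + f2 (A z)) / (f1 (A z) * f2 (A z)) * A' z = H (\<tau> z) * (2 / (n z * \<tau> z))" for z
    proof -
      have "f1 (A z) + f2 (A z) = \<tau> z" unfolding f1 f2 by (simp add: field_simps)
      moreover have "f1 (A z) \<noteq> 0" "f2 (A z) \<noteq> 0" using pos[of z] by auto
      ultimately show ?thesis using n(1)[of z] \<tau>(1)[of z] by (simp add: A'_def field_simps)
    qed
    then show ?thesis unfolding U2 by simp
  qed
  finally have "(\<integral>\<^sup>+s. ennreal (H (f1 s + f2 s) / (f1 s * f2 s)) \<partial>lborel) = \<dots>"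
    unfolding U1 by simp
  then show ?thesis
    unfolding phi_n phi_1 phi_2 n(2) \<tau>_def .
qed

text \<open>The density of the push-forward of d xi1 d xi2 / (phi1 phi2) at a given total energy and
  momentum. With squared invariant mass 4 (1 + r^2), the term \<open>sqrt (... - 4) / 2\<close> is
  the momentum r of either particle in the rest frame, and the condition on \<open>fst P\<close> is
  the threshold for producing a pair.\<close>

definition KG_density :: "real \<times> 'a::euclidean_space \<Rightarrow> real" where
  "KG_density P = (if fst P \<ge> sqrt (4 + (norm (snd P))\<^sup>2) then
      sphere_area DIM('a) * (sqrt ((fst P)\<^sup>2 - (norm (snd P))\<^sup>2 - 4) / 2) ^ (DIM('a) - 2)
        / sqrt ((fst P)\<^sup>2 - (norm (snd P))\<^sup>2) else 0)"

lemma borel_measurable_KG_density [measurable]: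
  "(KG_density :: real \<times> 'a::euclidean_space \<Rightarrow> real) \<in> borel_measurable borel"
proof -
  have "(KG_density :: real \<times> 'a \<Rightarrow> real) \<in> borel_measurable (borel \<Otimes>\<^sub>M borel)"
    unfolding KG_density_def[abs_def] by measurable
  then show ?thesis by (simp add: borel_prod)
qed

text \<open>The boost along \<open>\<eta>\<close> makes the integrand radial. Polar coordinates and
  the substitution of the total energy \<open>g r\<close> for \<open>r\<close> then produce the
  density.\<close>

lemma KG_pair_fibre:
  fixes \<eta> :: "'a::euclidean_space" and H :: "real \<Rightarrow> real"
  assumes d: "DIM('a) \<ge> 2" and [measurable]: "H \<in> borel_measurable borel"
  shows "(\<integral>\<^sup>+x. ennreal (H (phi x + phi (\<eta> - x)) / (phi x * phi (\<eta> - x))) \<partial>lborel)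
       = (\<integral>\<^sup>+\<tau>. ennreal (H \<tau> * KG_density (\<tau>, \<eta>)) \<partial>lborel)"
proof -
  define L where "L = norm \<eta>"
  obtain e :: 'a where e: "norm e = 1" "\<eta> = L *\<^sub>R e"
  proof (cases "\<eta> = 0")
    case True
    then show ?thesis using that[of "SOME b. b \<in> Basis"] by (simp add: L_def SOME_Basis)
  next
    case False
    then show ?thesis using that[of "\<eta> /\<^sub>R L"] by (simp add: L_def)
  qed
  have L: "L \<ge> 0" by (simp add: L_def)
  define S where "S = sphere_area DIM('a)"
  define g where "g r = sqrt (4 * (1 + r\<^sup>2) + L\<^sup>2)" for r
  have g: "g r > 0" "(g r)\<^sup>2 = 4 * (1 + r\<^sup>2) + L\<^sup>2" for r
  proof -
    have "4 * (1 + r\<^sup>2) + L\<^sup>2 > 0" by (simp add: add_pos_nonneg)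
    then show "g r > 0" "(g r)\<^sup>2 = 4 * (1 + r\<^sup>2) + L\<^sup>2" by (simp_all add: g_def)
  qed
  have dg: "(g has_real_derivative 4 * r / g r) (at r)" for r
    unfolding g_def using g[of r] by (auto intro!: derivative_eq_intros simp: divide_simps g_def)
  have contg: "continuous_on UNIV g"
    using dg DERIV_isCont continuous_at_imp_continuous_on by blast
  have [measurable]: "g \<in> borel_measurable borel" using contg by (rule borel_measurable_continuous_onI)
  have "(\<integral>\<^sup>+x. ennreal (H (phi x + phi (\<eta> - x)) / (phi x * phi (\<eta> - x))) \<partial>lborel)
      = (\<integral>\<^sup>+y. ennreal (H (phi (\<eta> /\<^sub>R 2 + y) + phi (\<eta> - (\<eta> /\<^sub>R 2 + y)))
          / (phi (\<eta> /\<^sub>R 2 + y) * phi (\<eta> - (\<eta> /\<^sub>R 2 + y)))) \<partial>lborel)"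
    by (rule nn_integral_lborel_translate[symmetric]) measurable
  also have "\<dots> = (\<integral>\<^sup>+y. ennreal (H (phi (\<eta> /\<^sub>R 2 + y) + phi (\<eta> /\<^sub>R 2 - y))
          / (phi (\<eta> /\<^sub>R 2 + y) * phi (\<eta> /\<^sub>R 2 - y))) \<partial>lborel)"
  proof -
    have eq: "\<eta> - (\<eta> /\<^sub>R 2 + y) = \<eta> /\<^sub>R 2 - y" for y
      using scaleR_half_double[of \<eta>] by (simp add: algebra_simps)
    show ?thesis by (simp only: eq)
  qed
  also have "\<dots> = (\<integral>\<^sup>+z. ennreal (H (sqrt (4 * (phi (z::'a))\<^sup>2 + L\<^sup>2))
            * (2 / (phi z * sqrt (4 * (phi z)\<^sup>2 + L\<^sup>2)))) \<partial>lborel)"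
    unfolding e(2)
  proof (rule nn_integral_cong_lines[OF _ _ e(1)])
    fix p assume p: "p \<bullet> e = 0"
    show "(\<integral>\<^sup>+s. ennreal (H (phi (L *\<^sub>R e /\<^sub>R 2 + (p + s *\<^sub>R e)) + phi (L *\<^sub>R e /\<^sub>R 2 - (p + s *\<^sub>R e)))
          / (phi (L *\<^sub>R e /\<^sub>R 2 + (p + s *\<^sub>R e)) * phi (L *\<^sub>R e /\<^sub>R 2 - (p + s *\<^sub>R e)))) \<partial>lborel)
       = (\<integral>\<^sup>+s. ennreal (H (sqrt (4 * (phi (p + s *\<^sub>R e))\<^sup>2 + L\<^sup>2))
          * (2 / (phi (p + s *\<^sub>R e) * sqrt (4 * (phi (p + s *\<^sub>R e))\<^sup>2 + L\<^sup>2)))) \<partial>lborel)"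
      by (rule KG_pair_line[OF _ e(1) p L]) measurable
  qed measurable
  also have "\<dots> = (\<integral>\<^sup>+r. ennreal (S * r ^ (DIM('a) - 1))
      * ennreal (H (g r) * (2 / (KG_phi r * g r))) * indicator {0..} r \<partial>lborel)"
    using nn_integral_radial[where 'a = 'a and h = "\<lambda>r. ennreal (H (g r) * (2 / (KG_phi r * g r)))"]
    by (simp add: g_def KG_phi_def S_def)
  also have "\<dots> = (\<integral>\<^sup>+r. ennreal (H (g r) * KG_density (g r, \<eta>) * (4 * r / g r)) * indicator (\<Union>n. {0..real n}) r \<partial>lborel)"
  proof (rule nn_integral_cong)
    fix r :: real
    have U: "(\<Union>n. {0..real n}) = {0..}"
      using real_arch_simple by (auto simp: set_eq_iff)
    \<comment> \<open>One of the d - 1 factors \<open>r\<close> is spent on the derivative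
      \<open>4 * r / g r\<close>; the other d - 2 remain in the density.\<close>
    have "S * r ^ (DIM('a) - 1) * (H (g r) * (2 / (KG_phi r * g r)))
        = H (g r) * KG_density (g r, \<eta>) * (4 * r / g r)" if r: "r \<ge> 0"
    proof -
      have gr: "g r \<ge> sqrt (4 + L\<^sup>2)" unfolding g_def by simp
      have s1: "sqrt ((g r)\<^sup>2 - L\<^sup>2 - 4) / 2 = r"
        using r by (simp add: g(2) real_sqrt_mult)
      have "(g r)\<^sup>2 - L\<^sup>2 = 4 * (1 + r\<^sup>2)" by (simp add: g(2))
      then have s2: "sqrt ((g r)\<^sup>2 - L\<^sup>2) = 2 * KG_phi r"
        by (simp only: KG_phi_def real_sqrt_mult real_sqrt_four)
      have "KG_density (g r, \<eta>) = S * r ^ (DIM('a) - 2) / (2 * KG_phi r)"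
        using gr by (simp add: KG_density_def s1 s2 S_def flip: L_def)
      moreover have "r ^ (DIM('a) - 1) = r ^ (DIM('a) - 2) * r"
        using d by (metis Suc_1 Suc_diff_le diff_Suc_Suc power_Suc2)
      ultimately show ?thesis using g(1)[of r] by (simp add: field_simps)
    qed
    moreover have "S \<ge> 0" by (simp add: S_def sphere_area_eq)
    ultimately show "ennreal (S * r ^ (DIM('a) - 1)) * ennreal (H (g r) * (2 / (KG_phi r * g r))) * indicator {0..} r
        = ennreal (H (g r) * KG_density (g r, \<eta>) * (4 * r / g r)) * indicator (\<Union>n. {0..real n}) r"
      unfolding U by (auto simp: indicator_def ennreal_mult'[symmetric])
  qed
  also have "\<dots> = (\<integral>\<^sup>+\<tau>. ennreal (H \<tau> * KG_density (\<tau>, \<eta>)) * indicator (\<Union>n. {g 0..g (real n)}) \<tau> \<partial>lborel)"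
  proof (rule nn_integral_substitution_Union[OF _ dg, symmetric])
    show "continuous_on UNIV (\<lambda>r. 4 * r / g r)"
      using g(1) by (intro continuous_intros contg) (auto simp: less_imp_neq[THEN not_sym])
    show "0 \<le> 4 * r / g r" if "r \<in> {0..real n}" for r n using that g(1)[of r] by auto
  qed (auto simp: decseq_def incseq_def)
  also have "\<dots> = (\<integral>\<^sup>+\<tau>. ennreal (H \<tau> * KG_density (\<tau>, \<eta>)) \<partial>lborel)"
  proof (rule nn_integral_cong)
    fix \<tau> :: real
    have "\<tau> \<in> (\<Union>n. {g 0..g (real n)})" if \<tau>: "\<tau> \<ge> g 0"
    proof -
      obtain n where n: "\<tau> \<le> real n" using real_arch_simple by blast
      have "g (real n) \<ge> real n"
        by (rule power2_le_imp_le) (use g[of "real n"] in auto)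
      then show ?thesis using n \<tau> by (auto intro!: exI[of _ n])
    qed
    moreover have "KG_density (\<tau>, \<eta>) = 0" if "\<tau> < g 0"
      using that by (simp add: KG_density_def g_def L_def)
    ultimately show "ennreal (H \<tau> * KG_density (\<tau>, \<eta>)) * indicator (\<Union>n. {g 0..g (real n)}) \<tau>
        = ennreal (H \<tau> * KG_density (\<tau>, \<eta>))"
      by (cases "\<tau> \<ge> g 0") (auto simp: indicator_def)
  qed
  finally show ?thesis .
qed

text \<open>Shifting the second variable fixes the total momentum, and the fibre identity integrates
  over its level sets. The integrals are over \<open>ennreal\<close>, so Tonelli permits all
  exchanges.\<close>

lemma KG_pair_integral:
  fixes H :: "real \<times> 'a::euclidean_space \<Rightarrow> real"
  assumes d: "DIM('a) \<ge> 2" and [measurable]: "H \<in> borel_measurable borel"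
  shows "(\<integral>\<^sup>+z. ennreal (H (phi (fst z) + phi (snd z), fst z + snd z) / (phi (fst z) * phi (snd z))) \<partial>(lborel :: ('a \<times> 'a) measure))
       = (\<integral>\<^sup>+P. ennreal (H P * KG_density P) \<partial>lborel)"
proof -
  have "(\<integral>\<^sup>+z. ennreal (H (phi (fst z) + phi (snd z), fst z + snd z) / (phi (fst z) * phi (snd z))) \<partial>(lborel :: ('a \<times> 'a) measure))
     = (\<integral>\<^sup>+x. \<integral>\<^sup>+y. ennreal (H (phi x + phi y, x + y) / (phi x * phi y)) \<partial>(lborel::'a measure) \<partial>(lborel::'a measure))"
    by (subst nn_integral_lborel_pair, measurable)
  also have "\<dots> = (\<integral>\<^sup>+x. \<integral>\<^sup>+\<eta>. ennreal (H (phi x + phi (\<eta> - x), \<eta>) / (phi x * phi (\<eta> - x))) \<partial>(lborel::'a measure) \<partial>(lborel::'a measure))"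
  proof (rule nn_integral_cong)
    fix x :: 'a
    show "(\<integral>\<^sup>+y. ennreal (H (phi x + phi y, x + y) / (phi x * phi y)) \<partial>(lborel::'a measure))
        = (\<integral>\<^sup>+\<eta>. ennreal (H (phi x + phi (\<eta> - x), \<eta>) / (phi x * phi (\<eta> - x))) \<partial>(lborel::'a measure))"
      using nn_integral_lborel_translate[of "\<lambda>\<eta>. ennreal (H (phi x + phi (\<eta> - x), \<eta>) / (phi x * phi (\<eta> - x)))" x]
      by simp
  qed
  also have "\<dots> = (\<integral>\<^sup>+\<eta>. \<integral>\<^sup>+x. ennreal (H (phi x + phi (\<eta> - x), \<eta>) / (phi x * phi (\<eta> - x))) \<partial>(lborel::'a measure) \<partial>(lborel::'a measure))"
    by (rule lborel_pair.Fubini') measurable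
  also have "\<dots> = (\<integral>\<^sup>+\<eta>. \<integral>\<^sup>+\<tau>. ennreal (H (\<tau>, \<eta>) * KG_density (\<tau>, \<eta>)) \<partial>lborel \<partial>(lborel::'a measure))"
    by (intro nn_integral_cong KG_pair_fibre[OF d]) measurable
  also have "\<dots> = (\<integral>\<^sup>+\<tau>. \<integral>\<^sup>+\<eta>. ennreal (H (\<tau>, \<eta>) * KG_density (\<tau>, \<eta>)) \<partial>(lborel::'a measure) \<partial>lborel)"
    by (rule lborel_pair.Fubini') measurable
  also have "\<dots> = (\<integral>\<^sup>+P. ennreal (H P * KG_density P) \<partial>lborel)"
    by (rule nn_integral_lborel_pair[symmetric]) (unfold borel_prod, measurable)
  finally show ?thesis .
qed

section \<open>The kernel\<close>

lemma norm_le_phi: "norm x \<le> phi x"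
  by (rule power2_le_imp_le) (simp_all add: phi_sq)

text \<open>With \<open>a\<close> and \<open>b\<close> as below, Cauchy-Schwarz gives
  \<open>a^2 - b^2 \<ge> (norm (x - y))^2\<close>; the factor \<open>a + b\<close> is at most
  \<open>2 * a\<close>. This quantifies how far the numerator of the kernel is from vanishing off
  the diagonal.\<close>

lemma KG_gap_ge:
  fixes x y :: "'a::euclidean_space"
  shows "(norm (x - y))\<^sup>2 / (2 * (phi x * phi y)) \<le> phi x * phi y - x \<bullet> y - 1"
proof -
  define a b where "a = phi x * phi y" and "b = 1 + x \<bullet> y"
  have a: "a > 0" by (simp add: a_def)
  have a2: "a\<^sup>2 = (1 + x \<bullet> x) * (1 + y \<bullet> y)"
    by (simp add: a_def power_mult_distrib phi_sq power2_norm_eq_inner)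
  have diff: "a\<^sup>2 - b\<^sup>2 \<ge> (norm (x - y))\<^sup>2"
  proof -
    have "(norm (x - y))\<^sup>2 = x \<bullet> x - 2 * (x \<bullet> y) + y \<bullet> y"
      unfolding power2_norm_eq_inner by (simp add: inner_diff_left inner_diff_right inner_commute[of y x])
    then show ?thesis
      using Cauchy_Schwarz_ineq[of x y] unfolding a2 b_def by (simp add: power2_eq_square algebra_simps)
  qed
  have "b\<^sup>2 \<le> a\<^sup>2" using diff zero_le_power2[of "norm (x - y)"] by linarith
  then have ba: "b \<le> a" using a by (rule power2_le_imp_le[OF _ less_imp_le])
  have "(norm (x - y))\<^sup>2 \<le> (a - b) * (a + b)" using diff by (simp add: power2_eq_square algebra_simps)
  also have "\<dots> \<le> (a - b) * (2 * a)" using ba by (intro mult_left_mono) auto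
  finally have "(norm (x - y))\<^sup>2 / (2 * a) \<le> a - b" using a by (simp add: divide_le_eq)
  then show ?thesis by (simp add: a_def b_def)
qed

lemma KG_gap_nonneg: "0 \<le> phi x * phi y - x \<bullet> y - 1"
  by (rule order_trans[OF _ KG_gap_ge]) simp

lemma KG_gap_pos: "x \<noteq> y \<Longrightarrow> 0 < phi x * phi y - x \<bullet> y - 1"
  by (rule less_le_trans[OF _ KG_gap_ge]) simp

lemma KG_kernel_nonneg: "KG_kernel x y \<ge> 0"
  using KG_gap_nonneg[of x y] by (simp add: KG_kernel_def)

lemma KG_kernel_commute: "KG_kernel x y = KG_kernel y x"
  by (simp add: KG_kernel_def inner_commute mult.commute)

lemma borel_measurable_KG_kernel [measurable (raw)]:
  assumes [measurable]: "f \<in> borel_measurable M" "g \<in> borel_measurable M"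
  shows "(\<lambda>z. KG_kernel (f z) (g z)) \<in> borel_measurable M"
  unfolding KG_kernel_def by measurable

text \<open>Away from the diagonal the kernel decays no faster than the power -(d - 1) of
  \<open>phi x * phi y\<close>: d - 2 factors come from the numerator, one from the denominator. For
  frozen \<open>y\<close> the exponential beats this power of \<open>phi x\<close>.\<close>

lemma exp_le_KG_kernel:
  fixes x y :: "'a::euclidean_space"
  assumes d: "DIM('a) \<ge> 2" and t: "t > 0" and \<delta>: "\<delta> > 0" "\<delta> \<le> norm (x - y)"
  shows "exp (- t * phi x) \<le>
    (2 * phi y) ^ (DIM('a) - 1) * (fact (DIM('a) - 1) / t ^ (DIM('a) - 1)) / \<delta> ^ (DIM('a) - 2) * KG_kernel x y"
proof -
  define n where "n = DIM('a) - 2"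
  have n: "DIM('a) - 1 = Suc n" "DIM('a) - 2 = n" using d by (auto simp: n_def)
  define a where "a = phi x * phi y"
  define p where "p = phi x * phi y - x \<bullet> y - 1"
  have a1: "a \<ge> 1" unfolding a_def using phi_ge_1[of x] phi_ge_1[of y] by (simp add: mult_ge1_I)
  have aa: "a \<le> a\<^sup>2" using a1 by (simp add: power2_eq_square mult_le_cancel_left1)
  \<comment> \<open>Weakened to a perfect square, so that the root of the gap has a rational lower
    bound.\<close>
  have "(\<delta> / (2 * a))\<^sup>2 \<le> \<delta>\<^sup>2 / (2 * a)"
  proof -
    have "\<delta>\<^sup>2 / (2 * a)\<^sup>2 \<le> \<delta>\<^sup>2 / (2 * a)"
    proof (rule divide_left_mono)
      have "2 * a \<le> 4 * a\<^sup>2" using a1 aa by linarith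
      then show "2 * a \<le> (2 * a)\<^sup>2" by (simp add: power_mult_distrib)
    qed (use a1 in auto)
    then show ?thesis by (simp add: power_divide)
  qed
  also have "\<dots> \<le> (norm (x - y))\<^sup>2 / (2 * a)"
    using \<delta> a1 by (intro divide_right_mono power_mono) auto
  also have "\<dots> \<le> p" unfolding a_def p_def by (rule KG_gap_ge)
  finally have "\<delta> / (2 * a) \<le> sqrt p" by (rule real_le_rsqrt)
  then have num: "(\<delta> / (2 * a)) ^ n \<le> sqrt p ^ n" using \<delta> a1 by (intro power_mono) auto
  have "norm x * norm y \<le> a" unfolding a_def by (intro mult_mono norm_le_phi) auto
  then have "p + 2 \<le> 3 * a"
    using a1 Cauchy_Schwarz_ineq2[of x y] by (simp add: p_def flip: a_def)
  also have "\<dots> \<le> (2 * a)\<^sup>2" using aa a1 unfolding power_mult_distrib by simp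
  finally have den: "sqrt (p + 2) \<le> 2 * a" using a1 by (intro real_le_lsqrt) auto
  have p0: "p \<ge> 0" unfolding p_def by (rule KG_gap_nonneg)
  have K: "KG_kernel x y = sqrt p ^ n / sqrt (p + 2)"
    by (simp add: KG_kernel_def n p_def)
  have le: "(\<delta> / (2 * a)) ^ n / (2 * a) \<le> KG_kernel x y"
    unfolding K using num den p0 a1 \<delta> by (intro frac_le) auto
  have "exp (- t * phi x) * (2 * a) ^ Suc n = (2 * phi y) ^ Suc n * (phi x ^ Suc n * exp (- t * phi x))"
    by (simp add: a_def power_mult_distrib mult_ac)
  also have "\<dots> \<le> (2 * phi y) ^ Suc n * (fact (Suc n) / t ^ Suc n)"
    by (intro mult_left_mono power_times_exp_le t) auto
  finally have up: "exp (- t * phi x) * (2 * a) ^ Suc n \<le> (2 * phi y) ^ Suc n * (fact (Suc n) / t ^ Suc n)" .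
  have "exp (- t * phi x) * (2 * a) ^ Suc n / \<delta> ^ n * ((\<delta> / (2 * a)) ^ n / (2 * a))
      \<le> (2 * phi y) ^ Suc n * (fact (Suc n) / t ^ Suc n) / \<delta> ^ n * KG_kernel x y"
    by (rule mult_mono[OF divide_right_mono[OF up] le]) (use \<delta> a1 t in auto)
  also have "exp (- t * phi x) * (2 * a) ^ Suc n / \<delta> ^ n * ((\<delta> / (2 * a)) ^ n / (2 * a)) = exp (- t * phi x)"
    using a1 \<delta> by (simp add: power_divide)
  finally show ?thesis unfolding n .
qed

section \<open>Integrability of the damped data\<close>

lemma integrable_exp_phi:
  assumes t: "t > 0"
  shows "integrable lborel (\<lambda>x::'a::euclidean_space. exp (- t * phi x))"
proof (rule integrableI_nonneg)
  define n where "n = DIM('a) - 1"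
  define C where "C = sphere_area DIM('a) * (fact n / (t / 2) ^ n)"
  have S: "sphere_area DIM('a) \<ge> 0" by (simp add: sphere_area_eq)
  then have C: "C \<ge> 0" using t by (simp add: C_def)
  have "(\<integral>\<^sup>+(x::'a). ennreal (exp (- t * phi x)) \<partial>lborel) \<le> (\<integral>\<^sup>+(x::'a). ennreal (exp (- t * norm x)) \<partial>lborel)"
  proof (intro nn_integral_mono ennreal_leI)
    fix x :: 'a
    show "exp (- t * phi x) \<le> exp (- t * norm x)" using t norm_le_phi[of x] by simp
  qed
  also have "\<dots> = (\<integral>\<^sup>+r. ennreal (sphere_area DIM('a) * r ^ n) * ennreal (exp (- t * r)) * indicator {0..} r \<partial>lborel)"
    unfolding n_def by (rule nn_integral_radial) measurable
  also have "\<dots> \<le> (\<integral>\<^sup>+r. ennreal (C * exp (- (t / 2) * r)) * indicator {0..} r \<partial>lborel)"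
  proof (rule nn_integral_mono)
    fix r :: real
    have "sphere_area DIM('a) * r ^ n * exp (- t * r) \<le> C * exp (- (t / 2) * r)" if r: "r \<ge> 0"
    proof -
      have "exp (- t * r) = exp (- (t / 2) * r) * exp (- (t / 2) * r)"
        by (subst exp_add[symmetric], rule arg_cong[where f = exp]) simp
      then have "sphere_area DIM('a) * r ^ n * exp (- t * r)
          = sphere_area DIM('a) * (r ^ n * exp (- (t / 2) * r)) * exp (- (t / 2) * r)" by simp
      also have "\<dots> \<le> C * exp (- (t / 2) * r)"
        unfolding C_def using S r t by (intro mult_right_mono mult_left_mono power_times_exp_le) auto
      finally show ?thesis .
    qed
    then show "ennreal (sphere_area DIM('a) * r ^ n) * ennreal (exp (- t * r)) * indicator {0..} r
        \<le> ennreal (C * exp (- (t / 2) * r)) * indicator {0..} r"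
      by (auto simp: indicator_def ennreal_mult''[symmetric] intro!: ennreal_leI)
  qed
  also have "\<dots> = ennreal (0 - (- C * exp (- (t / 2) * 0) / (t / 2)))"
  proof (rule nn_integral_FTC_atLeast)
    fix r :: real assume "0 \<le> r"
    show "((\<lambda>r. - C * exp (- (t / 2) * r) / (t / 2)) has_real_derivative C * exp (- (t / 2) * r)) (at r)"
      using t by (auto intro!: derivative_eq_intros)
    show "0 \<le> C * exp (- (t / 2) * r)" using C by simp
  next
    have "((\<lambda>r. exp (- ((t / 2) * r))) \<longlongrightarrow> 0) at_top"
      using t by (intro filterlim_compose[OF exp_at_bot] filterlim_compose[OF filterlim_uminus_at_bot_at_top]
          filterlim_tendsto_pos_mult_at_top[OF tendsto_const _ filterlim_ident]) auto
    then have "((\<lambda>r. - C / (t / 2) * exp (- ((t / 2) * r))) \<longlongrightarrow> - C / (t / 2) * 0) at_top"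
      by (rule tendsto_mult_left)
    then show "((\<lambda>r. - C * exp (- (t / 2) * r) / (t / 2)) \<longlongrightarrow> 0) at_top" by (simp add: mult_ac)
  qed measurable
  also have "\<dots> < \<infinity>" by simp
  finally show "(\<integral>\<^sup>+(x::'a). ennreal (exp (- t * phi x)) \<partial>lborel) < \<infinity>" .
qed auto

text \<open>The exponential is in L1 and in L2, and \<open>has_fourier\<close> includes
  integrability of \<open>F\<close> against every such test function.\<close>

lemma has_fourier_exp_integrable:
  assumes "has_fourier f F" and t: "t > 0"
  shows "integrable lborel (\<lambda>x::'a::euclidean_space. complex_of_real (exp (- t * phi x)) * F x)"
proof -
  let ?g = "\<lambda>x::'a. complex_of_real (exp (- t * phi x))"
  have "(\<lambda>x::'a. (cmod (?g x))\<^sup>2) = (\<lambda>x. exp (- (2 * t) * phi x))"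
    by (auto simp: power2_eq_square exp_add[symmetric])
  then have "integrable lborel ?g" "integrable lborel (\<lambda>x. (cmod (?g x))\<^sup>2)"
    using integrable_exp_phi[of t, where 'a = 'a] integrable_exp_phi[of "2 * t", where 'a = 'a] t
    by (simp_all only: complex_of_real_integrable_eq mult_pos_pos zero_less_numeral)
  then have "integrable lborel (\<lambda>x. F x * ?g x)"
    using assms(1) unfolding has_fourier_def by blast
  then show ?thesis by (simp only: mult.commute)
qed

text \<open>The kernel vanishes only on the diagonal, so finiteness of the energy for two distinct
  frequencies in the support of \<open>F\<close> controls \<open>F\<close> locally near every point.\<close>

lemma I2hat_finite_imp_integrable:
  fixes F :: "'a::euclidean_space \<Rightarrow> complex"
  assumes d: "DIM('a) \<ge> 2" and Fm: "F \<in> borel_measurable lborel" and I2: "I2hat F < \<infinity>" and t: "t > 0"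
  shows "integrable lborel (\<lambda>x. exp (- t * phi x) * (phi x * (cmod (F x))\<^sup>2))"
proof -
  have [measurable]: "F \<in> borel_measurable borel" using Fm by simp
  define w where "w x = phi x * (cmod (F x))\<^sup>2" for x
  have [measurable]: "w \<in> borel_measurable borel" unfolding w_def by measurable
  have w0: "w x \<ge> 0" for x by (simp add: w_def)
  have "I2hat F = (\<integral>\<^sup>+z. ennreal (w (fst z) * w (snd z) * KG_kernel (fst z) (snd z)) \<partial>(lborel \<Otimes>\<^sub>M lborel))"
    unfolding I2hat_def w_def by (simp add: mult_ac)
  also have "\<dots> = (\<integral>\<^sup>+x. \<integral>\<^sup>+y. ennreal (w x * w y * KG_kernel x y) \<partial>lborel \<partial>lborel)"
    by (subst lborel.nn_integral_fst[symmetric]) auto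
  finally have "AE x in lborel. (\<integral>\<^sup>+y. ennreal (w x * w y * KG_kernel x y) \<partial>lborel) \<noteq> \<infinity>"
    using I2 by (intro nn_integral_PInf_AE) auto
  then have AE: "AE x in lborel. (\<integral>\<^sup>+y. ennreal (w x * w y * KG_kernel x y) \<partial>lborel) < \<infinity>"
    by (simp add: less_top)
  show ?thesis
  proof (cases "AE x in lborel. w x = 0")
    case True
    then have "integrable lborel (\<lambda>x. exp (- t * phi x) * w x) \<longleftrightarrow> integrable lborel (\<lambda>x::'a. 0 :: real)"
      by (intro integrable_cong_AE) auto
    then show ?thesis by (simp add: w_def)
  next
    case False
    define good where "good y \<longleftrightarrow> w y > 0 \<and> (\<integral>\<^sup>+x. ennreal (w y * w x * KG_kernel y x) \<partial>lborel) < \<infinity>" for y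
    \<comment> \<open>Almost every point where \<open>w\<close> is positive is good. Since
      \<open>w\<close> is not almost everywhere 0 and a single point is a null set, one can avoid
      any prescribed \<open>c\<close>.\<close>
    have ex: "\<exists>y. y \<noteq> c \<and> good y" for c
    proof (rule ccontr)
      assume neg: "\<nexists>y. y \<noteq> c \<and> good y"
      have "AE x in lborel. w x = 0"
        using AE AE_lborel_singleton[of c]
      proof eventually_elim
        case (elim x)
        then show ?case using neg w0[of x] unfolding good_def by force
      qed
      then show False using False by blast
    qed
    obtain y1 where y1: "good y1" using ex by blast
    obtain y2 where y2: "good y2" "y2 \<noteq> y1" using ex by blast
    have int: "integrable lborel (\<lambda>x. w y * w x * KG_kernel y x)" if "good y" for y
      using that unfolding good_def
      by (intro integrableI_nonneg AE_I2 mult_nonneg_nonneg w0 KG_kernel_nonneg) auto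
    \<comment> \<open>By the triangle inequality every \<open>x\<close> is at distance at least
      \<open>\<delta>\<close> from one of the two points, so the sum of the two kernel bounds works
      everywhere.\<close>
    define \<delta> where "\<delta> = norm (y1 - y2) / 2"
    have \<delta>: "\<delta> > 0" using y2 by (simp add: \<delta>_def)
    define C where "C y = (2 * phi y) ^ (DIM('a) - 1) * (fact (DIM('a) - 1) / t ^ (DIM('a) - 1)) / \<delta> ^ (DIM('a) - 2)" for y :: 'a
    have C0: "C y \<ge> 0" for y using t \<delta> by (simp add: C_def)
    show ?thesis
      unfolding w_def[symmetric]
    proof (rule Bochner_Integration.integrable_bound)
      show "integrable lborel (\<lambda>x. C y1 / w y1 * (w y1 * w x * KG_kernel y1 x) + C y2 / w y2 * (w y2 * w x * KG_kernel y2 x))"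
        using int y1 y2 by (intro Bochner_Integration.integrable_add integrable_mult_right) auto
      show "AE x in lborel. norm (exp (- t * phi x) * w x)
          \<le> norm (C y1 / w y1 * (w y1 * w x * KG_kernel y1 x) + C y2 / w y2 * (w y2 * w x * KG_kernel y2 x))"
      proof (rule AE_I2)
        fix x
        have "norm (y1 - y2) \<le> norm (x - y1) + norm (x - y2)"
          using norm_triangle_ineq4[of "x - y2" "x - y1"] by (simp add: add.commute)
        then have "\<delta> \<le> norm (x - y1) \<or> \<delta> \<le> norm (x - y2)" by (auto simp: \<delta>_def)
        then have "exp (- t * phi x) \<le> C y1 * KG_kernel x y1 \<or> exp (- t * phi x) \<le> C y2 * KG_kernel x y2"
          using exp_le_KG_kernel[OF d t \<delta>(1)] unfolding C_def by blast
        moreover have "0 \<le> C y1 * KG_kernel x y1" "0 \<le> C y2 * KG_kernel x y2"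
          by (intro mult_nonneg_nonneg C0 KG_kernel_nonneg)+
        ultimately have "exp (- t * phi x) \<le> C y1 * KG_kernel y1 x + C y2 * KG_kernel y2 x"
          by (auto simp: KG_kernel_commute[of _ x])
        then have "exp (- t * phi x) * w x \<le> (C y1 * KG_kernel y1 x + C y2 * KG_kernel y2 x) * w x"
          using w0 by (intro mult_right_mono)
        also have "\<dots> = C y1 / w y1 * (w y1 * w x * KG_kernel y1 x) + C y2 / w y2 * (w y2 * w x * KG_kernel y2 x)"
          using y1 y2 by (simp add: good_def algebra_simps)
        finally show "norm (exp (- t * phi x) * w x)
          \<le> norm (C y1 / w y1 * (w y1 * w x * KG_kernel y1 x) + C y2 / w y2 * (w y2 * w x * KG_kernel y2 x))"
          using w0[of x] by simp
      qed
    qed measurable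
  qed
qed

section \<open>The pair density in terms of the kernel\<close>

lemma KG_invariant_mass:
  "(phi x + phi y)\<^sup>2 - (norm (x + y))\<^sup>2 = 2 * (phi x * phi y - x \<bullet> y + 1)"
proof -
  have "(norm (x + y))\<^sup>2 = (norm x)\<^sup>2 + 2 * (x \<bullet> y) + (norm y)\<^sup>2"
    by (simp add: power2_norm_eq_inner inner_add_left inner_add_right inner_commute)
  then show ?thesis by (simp add: power2_sum phi_sq)
qed

lemma KG_density_nonneg: "KG_density P \<ge> 0"
proof (cases "fst P \<ge> sqrt (4 + (norm (snd P))\<^sup>2)")
  case True
  then have "sqrt (4 + (norm (snd P))\<^sup>2) ^ 2 \<le> (fst P)\<^sup>2" by (intro power_mono) auto
  then have "(fst P)\<^sup>2 - (norm (snd P))\<^sup>2 - 4 \<ge> 0" by (simp add: add_nonneg_nonneg)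
  then show ?thesis by (simp add: KG_density_def sphere_area_eq)
qed (simp add: KG_density_def)

text \<open>With gap \<open>p\<close> the squared invariant mass is 2 (p + 2). The rest-frame
  momentum is then \<open>sqrt p / sqrt 2\<close>, which supplies d - 2 factors
  \<open>sqrt 2\<close> below the line; the invariant mass itself supplies one more, hence the
  exponent (d - 1)/2.\<close>

lemma KG_density_pair:
  fixes x y :: "'a::euclidean_space"
  assumes d: "DIM('a) \<ge> 2"
  shows "KG_density (phi x + phi y, x + y) = sphere_area DIM('a) / 2 powr ((real DIM('a) - 1) / 2) * KG_kernel x y"
proof -
  define n where "n = DIM('a) - 2"
  have n: "DIM('a) - 2 = n" "real DIM('a) - 1 = real (Suc n)" using d by (auto simp: n_def)
  define p where "p = phi x * phi y - x \<bullet> y - 1"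
  have p: "p \<ge> 0" unfolding p_def by (rule KG_gap_nonneg)
  have m: "(phi x + phi y)\<^sup>2 - (norm (x + y))\<^sup>2 = 2 * (p + 2)" unfolding KG_invariant_mass p_def by simp
  have ge: "sqrt (4 + (norm (x + y))\<^sup>2) \<le> phi x + phi y"
    by (rule real_le_lsqrt) (use m p in auto)
  have s: "sqrt (2 * (p + 2) - 4) / 2 = sqrt p / sqrt 2"
  proof -
    have "sqrt (2 * (p + 2) - 4) = sqrt 2 * sqrt p" by (simp add: real_sqrt_mult[symmetric])
    then show ?thesis by (simp add: field_simps)
  qed
  have pw: "2 powr (real (Suc n) / 2) = sqrt 2 ^ Suc n"
    by (subst powr_realpow[symmetric]) (simp_all add: powr_half_sqrt[symmetric] powr_powr)
  have "KG_density (phi x + phi y, x + y) = sphere_area DIM('a) * (sqrt p / sqrt 2) ^ n / sqrt (2 * (p + 2))"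
    using ge by (simp only: KG_density_def fst_conv snd_conv if_True m s n)
  also have "\<dots> = sphere_area DIM('a) / sqrt 2 ^ Suc n * (sqrt p ^ n / sqrt (p + 2))"
    by (simp only: real_sqrt_mult power_divide) simp
  also have "sqrt p ^ n / sqrt (p + 2) = KG_kernel x y"
    by (simp add: KG_kernel_def n p_def)
  finally show ?thesis unfolding n pw .
qed

text \<open>A positive gap puts the pair strictly above the threshold. At the threshold itself
  continuity can fail: in dimension two the density jumps there.\<close>

lemma isCont_KG_density:
  fixes x y :: "'a::euclidean_space"
  assumes xy: "x \<noteq> y"
  shows "isCont KG_density (phi x + phi y, x + y)"
proof -
  define U where "U = {P :: real \<times> 'a. sqrt (4 + (norm (snd P))\<^sup>2) < fst P}"
  have U: "open U" unfolding U_def by (intro open_Collect_less continuous_intros)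
  have "(phi x + phi y, x + y) \<in> U"
  proof -
    define A B where "A = (phi x + phi y)\<^sup>2" and "B = (norm (x + y))\<^sup>2"
    define p where "p = phi x * phi y - x \<bullet> y - 1"
    have "A - B = 2 * p + 4" unfolding A_def B_def KG_invariant_mass p_def by simp
    moreover have "p > 0" unfolding p_def by (rule KG_gap_pos[OF xy])
    ultimately have "4 + B < A" by linarith
    then have "4 + (norm (x + y))\<^sup>2 < (phi x + phi y)\<^sup>2" by (simp only: A_def B_def)
    then show ?thesis unfolding U_def by (auto intro!: real_less_lsqrt add_nonneg_nonneg)
  qed
  moreover have "continuous_on U KG_density"
  proof (subst continuous_on_cong[OF refl])
    show "KG_density P = sphere_area DIM('a) * (sqrt ((fst P)\<^sup>2 - (norm (snd P))\<^sup>2 - 4) / 2) ^ (DIM('a) - 2)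
        / sqrt ((fst P)\<^sup>2 - (norm (snd P))\<^sup>2)" if "P \<in> U" for P
      using that by (simp add: KG_density_def U_def)
    have "(fst P)\<^sup>2 - (norm (snd P))\<^sup>2 > 0" if "P \<in> U" for P
    proof -
      have "sqrt (4 + (norm (snd P))\<^sup>2) ^ 2 < (fst P)\<^sup>2"
        using that unfolding U_def by (intro power_strict_mono) auto
      then show ?thesis by (simp add: add_nonneg_nonneg)
    qed
    then show "continuous_on U (\<lambda>P. sphere_area DIM('a) * (sqrt ((fst P)\<^sup>2 - (norm (snd P))\<^sup>2 - 4) / 2) ^ (DIM('a) - 2)
        / sqrt ((fst P)\<^sup>2 - (norm (snd P))\<^sup>2))"
      by (intro continuous_intros) force+
  qed
  ultimately show ?thesis using U continuous_on_eq_continuous_at by blast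
qed

text \<open>The density grows at most like the power d - 2 of the energy. A bound of the damped
  density over all \<open>P\<close> bounds its Gaussian averages uniformly in the width.\<close>

lemma KG_density_bound:
  assumes t: "t > 0"
  shows "exp (- t * fst P) * KG_density (P :: real \<times> 'a::euclidean_space)
    \<le> sphere_area DIM('a) * (fact (DIM('a) - 2) / t ^ (DIM('a) - 2))"
proof (cases "fst P \<ge> sqrt (4 + (norm (snd P))\<^sup>2)")
  case True
  have S: "sphere_area DIM('a) \<ge> 0" by (simp add: sphere_area_eq)
  have "sqrt (4 + (norm (snd P))\<^sup>2) ^ 2 \<le> (fst P)\<^sup>2" using True by (intro power_mono) auto
  then have m: "(fst P)\<^sup>2 - (norm (snd P))\<^sup>2 \<ge> 4" by (simp add: add_nonneg_nonneg)
  have f0: "fst P \<ge> 0" by (rule order_trans[OF _ True]) simp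
  have "sqrt ((fst P)\<^sup>2 - (norm (snd P))\<^sup>2 - 4) \<le> fst P"
  proof (rule real_le_lsqrt[OF f0])
    show "(fst P)\<^sup>2 - (norm (snd P))\<^sup>2 - 4 \<le> (fst P)\<^sup>2"
      using zero_le_power2[of "norm (snd P)"] by linarith
  qed
  then have "sqrt ((fst P)\<^sup>2 - (norm (snd P))\<^sup>2 - 4) / 2 \<le> fst P" using f0 by simp
  then have 1: "(sqrt ((fst P)\<^sup>2 - (norm (snd P))\<^sup>2 - 4) / 2) ^ (DIM('a) - 2) \<le> fst P ^ (DIM('a) - 2)"
    using m by (intro power_mono) auto
  have 2: "1 \<le> sqrt ((fst P)\<^sup>2 - (norm (snd P))\<^sup>2)" using m by simp
  have "KG_density P \<le> sphere_area DIM('a) * fst P ^ (DIM('a) - 2) / 1"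
    using True S m 1 2 f0 by (simp only: KG_density_def if_True) (intro frac_le mult_left_mono, auto)
  then have "exp (- t * fst P) * KG_density P \<le> exp (- t * fst P) * (sphere_area DIM('a) * fst P ^ (DIM('a) - 2))"
    by (intro mult_left_mono) auto
  also have "\<dots> = sphere_area DIM('a) * (fst P ^ (DIM('a) - 2) * exp (- t * fst P))" by simp
  also have "\<dots> \<le> sphere_area DIM('a) * (fact (DIM('a) - 2) / t ^ (DIM('a) - 2))"
    by (intro mult_left_mono power_times_exp_le f0 t S)
  finally show ?thesis .
next
  case False
  then show ?thesis using t by (simp add: KG_density_def sphere_area_eq)
qed

section \<open>The deficit\<close>

definition pair_sum :: "'a \<times> 'a \<Rightarrow> real \<times> 'a::euclidean_space" where
  "pair_sum z = (phi (fst z) + phi (snd z), fst z + snd z)"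

definition pair_weight :: "'a::euclidean_space \<times> 'a \<Rightarrow> real" where
  "pair_weight z = phi (fst z) * phi (snd z)"

definition pair_amp :: "('a \<Rightarrow> complex) \<Rightarrow> 'a \<times> 'a \<Rightarrow> complex" where
  "pair_amp F z = F (fst z) * F (snd z)"

lemma pair_weight_pos [simp]: "pair_weight z > 0"
  by (simp add: pair_weight_def)

lemma fst_pair_sum_nonneg [simp]: "fst (pair_sum z) \<ge> 0"
  by (simp add: pair_sum_def)

lemma borel_measurable_pair_sum [measurable]:
  "(pair_sum :: 'a::euclidean_space \<times> 'a \<Rightarrow> _) \<in> borel_measurable borel"
proof -
  have "(pair_sum :: 'a \<times> 'a \<Rightarrow> _) \<in> borel_measurable (borel \<Otimes>\<^sub>M borel)"
    unfolding pair_sum_def[abs_def] by measurable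
  then show ?thesis by (simp add: borel_prod)
qed

lemma borel_measurable_fst_pair_sum [measurable]:
  "(\<lambda>z :: 'a::euclidean_space \<times> 'a. fst (pair_sum z)) \<in> borel_measurable borel"
proof -
  have "(\<lambda>z :: 'a \<times> 'a. fst (pair_sum z)) \<in> borel_measurable (borel \<Otimes>\<^sub>M borel)"
    unfolding pair_sum_def fst_conv by measurable
  then show ?thesis by (simp add: borel_prod)
qed

lemma borel_measurable_pair_weight [measurable]:
  "(pair_weight :: 'a::euclidean_space \<times> 'a \<Rightarrow> _) \<in> borel_measurable borel"
proof -
  have "(pair_weight :: 'a \<times> 'a \<Rightarrow> _) \<in> borel_measurable (borel \<Otimes>\<^sub>M borel)"
    unfolding pair_weight_def[abs_def] by measurable
  then show ?thesis by (simp add: borel_prod)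
qed

lemma borel_measurable_KG_kernel_pair [measurable]:
  "(\<lambda>z :: 'a::euclidean_space \<times> 'a. KG_kernel (fst z) (snd z)) \<in> borel_measurable borel"
proof -
  have "(\<lambda>z :: 'a \<times> 'a. KG_kernel (fst z) (snd z)) \<in> borel_measurable (borel \<Otimes>\<^sub>M borel)" by measurable
  then show ?thesis by (simp add: borel_prod)
qed

lemma borel_measurable_pair_amp [measurable]:
  fixes F :: "'a::euclidean_space \<Rightarrow> complex"
  assumes [measurable]: "F \<in> borel_measurable borel"
  shows "pair_amp F \<in> borel_measurable borel"
proof -
  have "pair_amp F \<in> borel_measurable (borel \<Otimes>\<^sub>M borel)"
    unfolding pair_amp_def[abs_def] by measurable
  then show ?thesis by (simp add: borel_prod)
qed

text \<open>The integrand of the regularised fourth power: two frequencies from u^2, two from its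
  conjugate, with conservation of energy and momentum relaxed by the Gaussian.\<close>

definition KG_off_diag :: "('a::euclidean_space \<Rightarrow> complex) \<Rightarrow> real \<Rightarrow> real \<Rightarrow> ('a \<times> 'a) \<times> ('a \<times> 'a) \<Rightarrow> real" where
  "KG_off_diag F t e w = exp (- t * (fst (pair_sum (fst w)) + fst (pair_sum (snd w)))) *
     (Re (pair_amp F (fst w) * cnj (pair_amp F (snd w))) * gauss_ft e (pair_sum (fst w) - pair_sum (snd w)))"

text \<open>The amplitude depends on the first pair only. Dividing by the weight of the second pair
  gives the measure whose push-forward has density \<open>KG_density\<close>.\<close>

definition KG_diag :: "('a::euclidean_space \<Rightarrow> complex) \<Rightarrow> real \<Rightarrow> real \<Rightarrow> ('a \<times> 'a) \<times> ('a \<times> 'a) \<Rightarrow> real" where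
  "KG_diag F t e w = exp (- t * (fst (pair_sum (fst w)) + fst (pair_sum (snd w)))) *
     ((cmod (pair_amp F (fst w)))\<^sup>2 * (pair_weight (fst w) / pair_weight (snd w))
       * gauss_ft e (pair_sum (fst w) - pair_sum (snd w)))"

definition KG_density_conv :: "real \<Rightarrow> real \<Rightarrow> real \<times> 'a::euclidean_space \<Rightarrow> real" where
  "KG_density_conv t e P0 = (LINT P|lborel. gauss_ft e (P0 - P) * (exp (- t * fst P) * KG_density P))"

context
  fixes F :: "'a::euclidean_space \<Rightarrow> complex"
  assumes d: "DIM('a) \<ge> 2" and Fm [measurable]: "F \<in> borel_measurable borel"
    and L1: "\<And>t. t > 0 \<Longrightarrow> integrable lborel (\<lambda>x. complex_of_real (exp (- t * phi x)) * F x)"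
    and L2: "\<And>t. t > 0 \<Longrightarrow> integrable lborel (\<lambda>x. exp (- t * phi x) * (phi x * (cmod (F x))\<^sup>2))"
begin

text \<open>The square of the evolution is an integral over pairs of frequencies in which energies
  and momenta add up in the phase. Hence the fourth power of the modulus is the squared modulus to
  which Parseval applies with \<open>S = pair_sum\<close>.\<close>

lemma KG_evolve_regularised:
  assumes t: "t > 0" and e: "e > 0"
  shows "integrable lborel (KG_off_diag F t e)"
    and "(\<integral>\<^sup>+q. ennreal ((cmod (KG_evolve F t (fst q) (snd q))) ^ 4 * exp (- e * (norm q)\<^sup>2 / 2)) \<partial>lborel)
       = ennreal (LINT w|lborel. KG_off_diag F t e w / (2 * pi) ^ (4 * DIM('a)))"
    and "0 \<le> (LINT w|lborel. KG_off_diag F t e w)"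
proof -
  define g where "g z = complex_of_real (exp (- t * fst (pair_sum z))) * pair_amp F z" for z
  define k where "k w = g (fst w) * cnj (g (snd w)) * complex_of_real (gauss_ft e (pair_sum (fst w) - pair_sum (snd w)))" for w
  define G where "G x = complex_of_real (exp (- t * phi x)) * F x" for x
  have G: "integrable lborel G" unfolding G_def by (rule L1[OF t])
  have gG: "g z = G (fst z) * G (snd z)" for z
    by (simp add: g_def G_def pair_amp_def pair_sum_def ring_distribs exp_add exp_diff exp_minus divide_inverse mult_ac)
  have g: "integrable lborel g"
    unfolding gG[abs_def] by (rule lborel_pair_product(1)[OF G G])
  have par: "integrable lborel k"
    "(\<integral>\<^sup>+q. ennreal ((cmod (LINT z|lborel. cis (q \<bullet> pair_sum z) * g z))\<^sup>2 * exp (- e * (norm q)\<^sup>2 / 2)) \<partial>lborel)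
       = ennreal (Re (LINT w|lborel. k w))"
    "0 \<le> Re (LINT w|lborel. k w)"
    unfolding k_def by (rule gauss_parseval[OF g _ e], measurable)+
  have Rek: "Re (k w) = KG_off_diag F t e w" for w
  proof -
    have "k w = complex_of_real (exp (- t * (fst (pair_sum (fst w)) + fst (pair_sum (snd w))))) *
        (pair_amp F (fst w) * cnj (pair_amp F (snd w)) * complex_of_real (gauss_ft e (pair_sum (fst w) - pair_sum (snd w))))"
      by (simp add: k_def g_def ring_distribs exp_add exp_diff exp_minus divide_inverse mult_ac)
    then show ?thesis by (simp add: KG_off_diag_def algebra_simps)
  qed
  show int: "integrable lborel (KG_off_diag F t e)"
    using integrable_Re[OF par(1)] unfolding Rek[abs_def] .
  have u2: "(cmod (KG_evolve F t (fst q) (snd q))) ^ 4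
      = (cmod (LINT z|lborel. cis (q \<bullet> pair_sum z) * g z))\<^sup>2 / (2 * pi) ^ (4 * DIM('a))" for q :: "real \<times> 'a"
  proof -
    define h where "h x = cis (snd q \<bullet> x + fst q * phi x) * G x" for x
    have h: "integrable lborel h" unfolding h_def by (rule integrable_cis_mult[OF G]) measurable
    have u: "KG_evolve F t (fst q) (snd q) = 1 / (2 * pi) ^ DIM('a) * (LINT x|lborel. h x)"
      unfolding KG_evolve_def h_def G_def by (simp add: cis_mult mult.assoc)
    have "(LINT x|lborel. h x)\<^sup>2 = (LINT z|lborel. h (fst z) * h (snd z))"
      unfolding lborel_pair_product(2)[OF h h] by (simp add: power2_eq_square)
    also have "\<dots> = (LINT z|lborel. cis (q \<bullet> pair_sum z) * g z)"
    proof (intro Bochner_Integration.integral_cong refl)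
      fix z :: "'a \<times> 'a"
      have "q \<bullet> pair_sum z = (snd q \<bullet> fst z + fst q * phi (fst z)) + (snd q \<bullet> snd z + fst q * phi (snd z))"
        by (simp add: pair_sum_def inner_prod_def inner_add_right distrib_left)
      then show "h (fst z) * h (snd z) = cis (q \<bullet> pair_sum z) * g z"
        unfolding h_def gG by (simp only: cis_mult[symmetric] mult_ac)
    qed
    finally have h2: "(cmod (LINT x|lborel. h x))\<^sup>2 = cmod (LINT z|lborel. cis (q \<bullet> pair_sum z) * g z)"
      by (metis norm_power)
    have "(cmod (KG_evolve F t (fst q) (snd q))) ^ 4 = ((cmod (LINT x|lborel. h x))\<^sup>2)\<^sup>2 / ((2 * pi) ^ DIM('a)) ^ 4"
      unfolding u by (simp add: norm_mult norm_divide norm_power power_divide power_mult_distrib)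
    then show ?thesis unfolding h2 power_mult[symmetric] by (simp only: mult.commute)
  qed
  have "(\<integral>\<^sup>+q. ennreal ((cmod (KG_evolve F t (fst q) (snd q))) ^ 4 * exp (- e * (norm q)\<^sup>2 / 2)) \<partial>lborel)
      = (\<integral>\<^sup>+q. ennreal (1 / (2 * pi) ^ (4 * DIM('a))) *
         ennreal ((cmod (LINT z|lborel. cis (q \<bullet> pair_sum z) * g z))\<^sup>2 * exp (- e * (norm q)\<^sup>2 / 2)) \<partial>(lborel :: (real \<times> 'a) measure))"
    unfolding u2 by (intro nn_integral_cong) (simp add: ennreal_mult'[symmetric])
  also have "\<dots> = ennreal (1 / (2 * pi) ^ (4 * DIM('a))) * ennreal (Re (LINT w|lborel. k w))"
  proof (subst nn_integral_cmult)
    have gm[measurable]: "g \<in> borel_measurable borel" using g by auto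
    have c[measurable]: "cis \<in> borel_measurable borel"
      unfolding cis_conv_exp[abs_def] by (intro borel_measurable_continuous_onI continuous_intros)
    have [measurable]: "(\<lambda>w. (fst w \<bullet> pair_sum (snd w) :: real)) \<in> borel_measurable ((borel :: (real \<times> 'a) measure) \<Otimes>\<^sub>M (borel :: ('a \<times> 'a) measure))"
      by measurable
    have "(\<lambda>q. LINT z|lborel. cis (q \<bullet> pair_sum z) * g z) \<in> borel_measurable (borel :: (real \<times> 'a) measure)"
      by (rule lborel.borel_measurable_lebesgue_integral) (simp add: case_prod_beta')
    then show "(\<lambda>q. ennreal ((cmod (LINT z|lborel. cis (q \<bullet> pair_sum z) * g z))\<^sup>2 * exp (- e * (norm q)\<^sup>2 / 2))) \<in> borel_measurable (lborel :: (real \<times> 'a) measure)"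
      by simp
    show "ennreal (1 / (2 * pi) ^ (4 * DIM('a))) * (\<integral>\<^sup>+q. ennreal ((cmod (LINT z|lborel. cis (q \<bullet> pair_sum z) * g z))\<^sup>2 * exp (- e * (norm q)\<^sup>2 / 2)) \<partial>lborel)
      = ennreal (1 / (2 * pi) ^ (4 * DIM('a))) * ennreal (Re (LINT w|lborel. k w))"
      by (simp only: par(2))
  qed
  also have Reint: "Re (LINT w|lborel. k w) = (LINT w|lborel. KG_off_diag F t e w)"
    unfolding Rek[symmetric] by (rule integral_Re[OF par(1), symmetric])
  finally show "(\<integral>\<^sup>+q. ennreal ((cmod (KG_evolve F t (fst q) (snd q))) ^ 4 * exp (- e * (norm q)\<^sup>2 / 2)) \<partial>lborel)
       = ennreal (LINT w|lborel. KG_off_diag F t e w / (2 * pi) ^ (4 * DIM('a)))"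
    by (simp add: ennreal_mult'[symmetric])
  show "0 \<le> (LINT w|lborel. KG_off_diag F t e w)" using par(3) unfolding Reint .
qed

lemma pair_energy_integrable:
  assumes t: "t > 0"
  shows "integrable lborel (\<lambda>z. exp (- t * fst (pair_sum z)) * ((cmod (pair_amp F z))\<^sup>2 * pair_weight z))"
proof -
  have "exp (- t * fst (pair_sum z)) * ((cmod (pair_amp F z))\<^sup>2 * pair_weight z)
      = (exp (- t * phi (fst z)) * (phi (fst z) * (cmod (F (fst z)))\<^sup>2)) * (exp (- t * phi (snd z)) * (phi (snd z) * (cmod (F (snd z)))\<^sup>2))" for z
    by (simp add: pair_sum_def pair_amp_def pair_weight_def norm_mult power_mult_distrib ring_distribs
        exp_add exp_diff exp_minus divide_inverse mult_ac)
  then show ?thesis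
    using lborel_pair_product(1)[OF L2[OF t] L2[OF t]] by simp
qed

text \<open>The upper bound is free of \<open>e\<close>, as dominated convergence will require; the
  last claim identifies the convolution with the integral over the second pair in the diagonal
  term.\<close>

lemma KG_density_conv_bounds:
  assumes t: "t > 0" and e: "e > 0"
  shows "0 \<le> KG_density_conv t e (P0 :: real \<times> 'a)"
    and "KG_density_conv t e (P0 :: real \<times> 'a)
      \<le> (2 * pi) ^ (DIM('a) + 1) * (sphere_area DIM('a) * (fact (DIM('a) - 2) / t ^ (DIM('a) - 2)))"
    and "KG_density_conv t e \<in> borel_measurable (borel :: (real \<times> 'a) measure)"
    and "(\<integral>\<^sup>+z. ennreal (exp (- t * fst (pair_sum z)) * gauss_ft e (P0 - pair_sum z) / pair_weight z) \<partial>(lborel :: ('a \<times> 'a) measure))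
      = ennreal (KG_density_conv t e P0)"
proof -
  have fstm[measurable]: "(fst :: real \<times> 'a \<Rightarrow> real) \<in> borel_measurable borel"
    by (intro borel_measurable_continuous_onI continuous_intros)
  have Bm[measurable]: "(\<lambda>P :: real \<times> 'a. exp (- t * fst P) * KG_density P) \<in> borel_measurable borel"
    by measurable
  have B0: "0 \<le> exp (- t * fst P) * KG_density P" for P :: "real \<times> 'a"
    by (simp add: KG_density_nonneg)
  show "0 \<le> KG_density_conv t e P0" "KG_density_conv t e P0
      \<le> (2 * pi) ^ (DIM('a) + 1) * (sphere_area DIM('a) * (fact (DIM('a) - 2) / t ^ (DIM('a) - 2)))"
    using gauss_convolution_bound[OF e Bm B0 KG_density_bound[OF t], of P0]
    unfolding KG_density_conv_def by simp_all
  have "(\<lambda>w :: (real \<times> 'a) \<times> (real \<times> 'a). gauss_ft e (fst w - snd w) * (exp (- t * fst (snd w)) * KG_density (snd w)))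
      \<in> borel_measurable (borel \<Otimes>\<^sub>M borel)"
    by (intro borel_measurable_times measurable_compose[OF _ borel_measurable_gauss_ft]
        measurable_compose[OF measurable_snd Bm] borel_measurable_diff measurable_fst measurable_snd
        measurable_compose[OF measurable_snd, of "\<lambda>P. exp (- t * fst P)"]
        measurable_compose[OF measurable_snd borel_measurable_KG_density]) measurable
  then show "KG_density_conv t e \<in> borel_measurable (borel :: (real \<times> 'a) measure)"
    unfolding KG_density_conv_def[abs_def]
    by (intro lborel.borel_measurable_lebesgue_integral) (simp add: case_prod_beta')
  have Hm: "(\<lambda>P. exp (- t * fst P) * gauss_ft e (P0 - P)) \<in> borel_measurable borel"
    by measurable
  have "(\<integral>\<^sup>+z. ennreal (exp (- t * fst (pair_sum z)) * gauss_ft e (P0 - pair_sum z) / pair_weight z) \<partial>(lborel :: ('a \<times> 'a) measure))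
      = (\<integral>\<^sup>+P. ennreal (exp (- t * fst P) * gauss_ft e (P0 - P) * KG_density P) \<partial>lborel)"
    using KG_pair_integral[OF d Hm] by (simp add: pair_sum_def pair_weight_def)
  also have "\<dots> = (\<integral>\<^sup>+P. ennreal (gauss_ft e (P0 - P) * (exp (- t * fst P) * KG_density P)) \<partial>lborel)"
    by (simp add: mult_ac)
  also have "\<dots> = ennreal (KG_density_conv t e P0)"
    unfolding KG_density_conv_def
    by (rule nn_integral_eq_integral[OF gauss_convolution_scale(1)[OF e Bm B0 KG_density_bound[OF t]]])
       (use e in \<open>auto simp: KG_density_nonneg\<close>)
  finally show "(\<integral>\<^sup>+z. ennreal (exp (- t * fst (pair_sum z)) * gauss_ft e (P0 - pair_sum z) / pair_weight z) \<partial>(lborel :: ('a \<times> 'a) measure))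
      = ennreal (KG_density_conv t e P0)" .
qed

lemma KG_diag_measurable [measurable]: "KG_diag F t e \<in> borel_measurable borel"
proof -
  have "KG_diag F t e \<in> borel_measurable (borel \<Otimes>\<^sub>M borel)"
    unfolding KG_diag_def[abs_def] by measurable
  then show ?thesis by (simp add: borel_prod)
qed

lemma KG_diag_nonneg: "e > 0 \<Longrightarrow> KG_diag F t e w \<ge> 0"
  by (simp add: KG_diag_def less_imp_le)

text \<open>Tonelli: integrating out the second pair leaves the energy density of the first pair
  times a bounded function.\<close>

lemma KG_diag_integral:
  assumes t: "t > 0" and e: "e > 0"
  shows "integrable lborel (KG_diag F t e)"
    and "(LINT w|lborel. KG_diag F t e w) =
      (LINT z|lborel. exp (- t * fst (pair_sum z)) * ((cmod (pair_amp F z))\<^sup>2 * pair_weight z)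
         * KG_density_conv t e (pair_sum z))"
proof -
  define a where "a z = exp (- t * fst (pair_sum z)) * ((cmod (pair_amp F z))\<^sup>2 * pair_weight z)" for z
  have a0: "a z \<ge> 0" for z by (simp add: a_def less_imp_le)
  have am[measurable]: "a \<in> borel_measurable borel" unfolding a_def by measurable
  have [measurable]: "KG_density_conv t e \<in> borel_measurable (borel :: (real \<times> 'a) measure)"
    by (rule KG_density_conv_bounds(3)[OF t e])
  define C where "C = (2 * pi) ^ (DIM('a) + 1) * (sphere_area DIM('a) * (fact (DIM('a) - 2) / t ^ (DIM('a) - 2)))"
  have conv: "0 \<le> KG_density_conv t e (P0 :: real \<times> 'a)" "KG_density_conv t e (P0 :: real \<times> 'a) \<le> C" for P0
    unfolding C_def by (rule KG_density_conv_bounds[OF t e])+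
  have int: "integrable lborel (\<lambda>z. a z * KG_density_conv t e (pair_sum z))"
  proof (rule Bochner_Integration.integrable_bound)
    show "integrable lborel (\<lambda>z. C * a z)" unfolding a_def using pair_energy_integrable[OF t] by simp
    show "AE z in lborel. norm (a z * KG_density_conv t e (pair_sum z)) \<le> norm (C * a z)"
    proof (rule AE_I2)
      fix z
      have "a z * KG_density_conv t e (pair_sum z) \<le> a z * C" using conv a0 by (intro mult_left_mono)
      then show "norm (a z * KG_density_conv t e (pair_sum z)) \<le> norm (C * a z)"
        using conv[of "pair_sum z"] a0[of z] by (simp add: abs_mult mult.commute)
    qed
  qed measurable
  have dm[measurable]: "(\<lambda>w. ennreal (KG_diag F t e w)) \<in> borel_measurable (borel \<Otimes>\<^sub>M borel)"
    unfolding KG_diag_def[abs_def] by measurable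
  have "(\<integral>\<^sup>+w. ennreal (KG_diag F t e w) \<partial>lborel) = (\<integral>\<^sup>+z. \<integral>\<^sup>+z'. ennreal (KG_diag F t e (z, z')) \<partial>lborel \<partial>lborel)"
    by (rule nn_integral_lborel_pair[OF dm])
  also have "\<dots> = (\<integral>\<^sup>+z. ennreal (a z * KG_density_conv t e (pair_sum z)) \<partial>lborel)"
  proof (rule nn_integral_cong)
    fix z :: "'a \<times> 'a"
    have eq: "KG_diag F t e (z, z') = a z * (exp (- t * fst (pair_sum z')) * gauss_ft e (pair_sum z - pair_sum z') / pair_weight z')" for z'
      by (simp add: KG_diag_def a_def ring_distribs exp_add exp_diff exp_minus divide_inverse mult_ac)
    have "(\<integral>\<^sup>+z'. ennreal (KG_diag F t e (z, z')) \<partial>lborel)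
        = ennreal (a z) * (\<integral>\<^sup>+z'. ennreal (exp (- t * fst (pair_sum z')) * gauss_ft e (pair_sum z - pair_sum z') / pair_weight z') \<partial>lborel)"
      unfolding eq by (subst nn_integral_cmult[symmetric], measurable) (simp only: ennreal_mult'[OF a0])
    also have "\<dots> = ennreal (a z * KG_density_conv t e (pair_sum z))"
      unfolding KG_density_conv_bounds(4)[OF t e] by (simp add: ennreal_mult'[OF a0])
    finally show "(\<integral>\<^sup>+z'. ennreal (KG_diag F t e (z, z')) \<partial>lborel) = ennreal (a z * KG_density_conv t e (pair_sum z))" .
  qed
  also have "\<dots> = ennreal (LINT z|lborel. a z * KG_density_conv t e (pair_sum z))"
    by (rule nn_integral_eq_integral[OF int]) (use a0 conv in auto)
  finally have nn: "(\<integral>\<^sup>+w. ennreal (KG_diag F t e w) \<partial>lborel) = \<dots>" .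
  show "integrable lborel (KG_diag F t e)"
    by (rule integrableI_nonneg) (use KG_diag_nonneg[OF e] nn in auto)
  have "(LINT w|lborel. KG_diag F t e w) = enn2real (\<integral>\<^sup>+w. ennreal (KG_diag F t e w) \<partial>lborel)"
    by (rule integral_eq_nn_integral) (use KG_diag_nonneg[OF e] in auto)
  also have "\<dots> = (LINT z|lborel. a z * KG_density_conv t e (pair_sum z))"
    unfolding nn by (intro enn2real_ennreal integral_nonneg_AE) (use a0 conv in auto)
  finally show "(LINT w|lborel. KG_diag F t e w) =
      (LINT z|lborel. exp (- t * fst (pair_sum z)) * ((cmod (pair_amp F z))\<^sup>2 * pair_weight z)
         * KG_density_conv t e (pair_sum z))" by (simp add: a_def)
qed

lemma KG_diag_swap:
  assumes t: "t > 0" and e: "e > 0"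
  shows "integrable lborel (\<lambda>w. KG_diag F t e (snd w, fst w))"
    and "(LINT w|lborel. KG_diag F t e (snd w, fst w)) = (LINT w|lborel. KG_diag F t e w)"
  using lborel_pair.integrable_product_swap[of "KG_diag F t e"] lborel_pair.integral_product_swap[of "KG_diag F t e"]
    KG_diag_integral(1)[OF t e]
  by (simp_all add: lborel_prod case_prod_beta')

text \<open>In the limit the second pair is forced to the energy of the first, so the two dampings
  combine and the exponent doubles to \<open>- 2 * t\<close>.\<close>

lemma KG_diag_tendsto:
  assumes t: "t > 0" and e: "\<And>n. e n > 0" "e \<longlonglongrightarrow> 0"
  shows "(\<lambda>n. LINT w|lborel. KG_diag F t (e n) w) \<longlonglongrightarrow>
    (2 * pi) ^ (DIM('a) + 1) * (sphere_area DIM('a) / 2 powr ((real DIM('a) - 1) / 2)) *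
    (LINT z|lborel. exp (- 2 * t * fst (pair_sum z)) * ((cmod (pair_amp F z))\<^sup>2 * pair_weight z)
       * KG_kernel (fst z) (snd z))"
proof -
  define a where "a z = exp (- t * fst (pair_sum z)) * ((cmod (pair_amp F z))\<^sup>2 * pair_weight z)" for z
  have a0: "a z \<ge> 0" for z by (simp add: a_def less_imp_le)
  have am[measurable]: "a \<in> borel_measurable borel" unfolding a_def by measurable
  have cm[measurable]: "KG_density_conv t (e n) \<in> borel_measurable (borel :: (real \<times> 'a) measure)" for n
    by (rule KG_density_conv_bounds(3)[OF t e(1)])
  define C where "C = (2 * pi) ^ (DIM('a) + 1) * (sphere_area DIM('a) * (fact (DIM('a) - 2) / t ^ (DIM('a) - 2)))"
  have conv: "0 \<le> KG_density_conv t (e n) (P0 :: real \<times> 'a)" "KG_density_conv t (e n) (P0 :: real \<times> 'a) \<le> C" for P0 n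
    unfolding C_def by (rule KG_density_conv_bounds[OF t e(1)])+
  define c where "c = (2 * pi) ^ (DIM('a) + 1) * (sphere_area DIM('a) / 2 powr ((real DIM('a) - 1) / 2))"
  have fstm[measurable]: "(fst :: real \<times> 'a \<Rightarrow> real) \<in> borel_measurable borel"
    by (intro borel_measurable_continuous_onI continuous_intros)
  \<comment> \<open>Off the diagonal, that is almost everywhere, the density is continuous at
    \<open>pair_sum z\<close>, and the Gaussian averages converge there.\<close>
  have off: "AE z in (lborel :: ('a \<times> 'a) measure). fst z \<noteq> snd z"
  proof -
    have "AE z in lborel \<Otimes>\<^sub>M (lborel :: 'a measure). fst z \<noteq> (snd z :: 'a)"
    proof (rule lborel_pair.AE_pair_measure)
      show "{z \<in> space (lborel \<Otimes>\<^sub>M lborel). fst z \<noteq> (snd z :: 'a)} \<in> sets (lborel \<Otimes>\<^sub>M lborel)"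
        by measurable
      show "AE x in lborel. AE y in lborel. fst (x, y) \<noteq> (snd (x, y) :: 'a)"
      proof (rule AE_I2)
        fix x :: 'a
        show "AE y in lborel. fst (x, y) \<noteq> snd (x, y)"
          using AE_lborel_singleton[of x] by eventually_elim simp
      qed
    qed
    then show ?thesis by (simp only: lborel_prod)
  qed
  have "(\<lambda>n. LINT z|lborel. a z * KG_density_conv t (e n) (pair_sum z)) \<longlonglongrightarrow>
      (LINT z|lborel. a z * (c * (exp (- t * fst (pair_sum z)) * KG_kernel (fst z) (snd z))))"
  proof (rule integral_dominated_convergence[where w = "\<lambda>z. a z * C"])
    show "integrable lborel (\<lambda>z. a z * C)" unfolding a_def using pair_energy_integrable[OF t] by simp
    show "AE z in lborel. norm (a z * KG_density_conv t (e n) (pair_sum z)) \<le> a z * C" for n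
      using a0 conv by (intro AE_I2) (simp add: abs_mult mult_left_mono)
    show "AE z in lborel. (\<lambda>n. a z * KG_density_conv t (e n) (pair_sum z)) \<longlonglongrightarrow>
        a z * (c * (exp (- t * fst (pair_sum z)) * KG_kernel (fst z) (snd z)))"
      using off
    proof eventually_elim
      case (elim z)
      have Bm: "(\<lambda>P :: real \<times> 'a. exp (- t * fst P) * KG_density P) \<in> borel_measurable borel"
        by measurable
      have B0: "0 \<le> exp (- t * fst P) * KG_density P" for P :: "real \<times> 'a"
        by (simp add: KG_density_nonneg)
      have "isCont (\<lambda>P. exp (- t * fst P) * KG_density P) (pair_sum z)"
        using isCont_KG_density[OF elim] unfolding pair_sum_def by (intro continuous_intros) auto
      then have "(\<lambda>n. KG_density_conv t (e n) (pair_sum z)) \<longlonglongrightarrow>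
          (2 * pi) ^ DIM(real \<times> 'a) * (exp (- t * fst (pair_sum z)) * KG_density (pair_sum z))"
        unfolding KG_density_conv_def
        by (rule gauss_convolution_tendsto[OF Bm B0 KG_density_bound[OF t] _ e])
      also have "(2 * pi) ^ DIM(real \<times> 'a) * (exp (- t * fst (pair_sum z)) * KG_density (pair_sum z))
          = c * (exp (- t * fst (pair_sum z)) * KG_kernel (fst z) (snd z))"
        using KG_density_pair[OF d, of "fst z" "snd z"] by (simp add: c_def pair_sum_def)
      finally show ?case by (rule tendsto_mult_left)
    qed
  qed measurable
  also have "(LINT z|lborel. a z * (c * (exp (- t * fst (pair_sum z)) * KG_kernel (fst z) (snd z))))
      = c * (LINT z|lborel. exp (- 2 * t * fst (pair_sum z)) * ((cmod (pair_amp F z))\<^sup>2 * pair_weight z)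
       * KG_kernel (fst z) (snd z))"
  proof -
    have e2: "exp (- 2 * t * fst (pair_sum z)) = exp (- t * fst (pair_sum z)) * exp (- t * fst (pair_sum z))" for z :: "'a \<times> 'a"
      by (subst exp_add[symmetric], rule arg_cong[where f = exp]) simp
    have ae: "a z * (c * (exp (- t * fst (pair_sum z)) * KG_kernel (fst z) (snd z)))
        = c * (exp (- 2 * t * fst (pair_sum z)) * ((cmod (pair_amp F z))\<^sup>2 * pair_weight z) * KG_kernel (fst z) (snd z))" for z
      unfolding a_def e2 by (simp only: mult_ac)
    show ?thesis unfolding ae by (rule Bochner_Integration.integral_mult_right_zero)
  qed
  finally show ?thesis
    unfolding KG_diag_integral(2)[OF t e(1)] a_def c_def .
qed

section \<open>The damped energy and the limit of the deficits\<close>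

lemma I2hat_damped:
  "enn2real (I2hat (\<lambda>x. complex_of_real (exp (- t * phi x)) * F x))
    = (LINT z|lborel. exp (- 2 * t * fst (pair_sum z)) * ((cmod (pair_amp F z))\<^sup>2 * pair_weight z)
       * KG_kernel (fst z) (snd z))"
proof -
  have e2: "exp (- 2 * t * fst (pair_sum z)) = (exp (- t * phi (fst z)))\<^sup>2 * (exp (- t * phi (snd z)))\<^sup>2" for z :: "'a \<times> 'a"
    unfolding power2_eq_square exp_add[symmetric]
    by (rule arg_cong[where f = exp]) (simp add: pair_sum_def algebra_simps)
  have "I2hat (\<lambda>x. complex_of_real (exp (- t * phi x)) * F x)
      = (\<integral>\<^sup>+z. ennreal (exp (- 2 * t * fst (pair_sum z)) * ((cmod (pair_amp F z))\<^sup>2 * pair_weight z)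
       * KG_kernel (fst z) (snd z)) \<partial>lborel)"
    unfolding I2hat_def lborel_prod e2
    by (intro nn_integral_cong arg_cong[where f = ennreal])
       (simp add: pair_amp_def pair_weight_def norm_mult power_mult_distrib mult_ac)
  \<comment> \<open>For an infinite integral both \<open>enn2real\<close> and the Bochner integral
    would return 0, so the conversion holds in every case.\<close>
  then show ?thesis
    by (subst integral_eq_nn_integral) (auto simp: KG_kernel_nonneg less_imp_le)
qed

text \<open>The diagonal integrand need not dominate the other one pointwise. Averaged with its copy
  under exchange of the pairs, which has the same integral, it does.\<close>

lemma deficit_chain:
  assumes e: "e > 0"
  shows "\<exists>h. cm_chain h \<and> (\<forall>t>0. h 0 t = (LINT w|lborel. KG_diag F t e w) - (LINT w|lborel. KG_off_diag F t e w))"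
proof -
  define \<Phi> where "\<Phi> w = fst (pair_sum (fst w)) + fst (pair_sum (snd w))" for w :: "('a \<times> 'a) \<times> ('a \<times> 'a)"
  define r where "r w = pair_weight (fst w) / pair_weight (snd w)" for w :: "('a \<times> 'a) \<times> ('a \<times> 'a)"
  define v where "v w = (((cmod (pair_amp F (fst w)))\<^sup>2 * r w + (cmod (pair_amp F (snd w)))\<^sup>2 / r w) / 2
      - Re (pair_amp F (fst w) * cnj (pair_amp F (snd w)))) * gauss_ft e (pair_sum (fst w) - pair_sum (snd w))" for w
  have decomp: "exp (- t * \<Phi> w) * v w = (KG_diag F t e w + KG_diag F t e (snd w, fst w)) / 2 - KG_off_diag F t e w" for t w
  proof -
    have g: "gauss_ft e (pair_sum (snd w) - pair_sum (fst w)) = gauss_ft e (pair_sum (fst w) - pair_sum (snd w))"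
      by (rule gauss_ft_minus_commute)
    have sw: "KG_diag F t e (snd w, fst w) = exp (- t * \<Phi> w) * ((cmod (pair_amp F (snd w)))\<^sup>2 / r w
        * gauss_ft e (pair_sum (fst w) - pair_sum (snd w)))"
      unfolding KG_diag_def \<Phi>_def r_def fst_conv snd_conv g by (simp add: add.commute)
    show ?thesis
      unfolding sw KG_diag_def[of F t e w] KG_off_diag_def v_def \<Phi>_def r_def by (simp add: algebra_simps)
  qed
  have m: "\<Phi> \<in> borel_measurable lborel" "v \<in> borel_measurable lborel"
  proof -
    have "\<Phi> \<in> borel_measurable (borel \<Otimes>\<^sub>M borel)"
      unfolding \<Phi>_def
      by (intro borel_measurable_add measurable_compose[OF measurable_fst borel_measurable_fst_pair_sum]
          measurable_compose[OF measurable_snd borel_measurable_fst_pair_sum])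
    moreover have [measurable]: "cnj \<in> borel_measurable borel"
      by (intro borel_measurable_continuous_onI continuous_intros)
    have "v \<in> borel_measurable (borel \<Otimes>\<^sub>M borel)"
      unfolding v_def r_def by measurable
    ultimately show "\<Phi> \<in> borel_measurable lborel" "v \<in> borel_measurable lborel" by (simp_all add: borel_prod)
  qed
  have v0: "v w \<ge> 0" for w
  proof -
    have r: "r w > 0" by (simp add: r_def)
    have amgm: "p * q \<le> (p\<^sup>2 + q\<^sup>2) / 2" for p q :: real
      using sum_squares_bound[of p q] by simp
    define x y where "x = cmod (pair_amp F (fst w))" and "y = cmod (pair_amp F (snd w))"
    have "Re (pair_amp F (fst w) * cnj (pair_amp F (snd w))) \<le> x * y"
      using complex_Re_le_cmod[of "pair_amp F (fst w) * cnj (pair_amp F (snd w))"] by (simp add: x_def y_def norm_mult)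
    \<comment> \<open>Splitting off \<open>sqrt (r w)\<close> makes the arithmetic-geometric mean
      inequality produce \<open>r w\<close> on one square and its reciprocal on the other, matching
      the diagonal term and its exchanged copy.\<close>
    also have "x * y = (x * sqrt (r w)) * (y / sqrt (r w))" using r by simp
    also have "\<dots> \<le> ((x * sqrt (r w))\<^sup>2 + (y / sqrt (r w))\<^sup>2) / 2"
      by (rule amgm)
    also have "\<dots> = (x\<^sup>2 * r w + y\<^sup>2 / r w) / 2" using r by (simp add: power_mult_distrib power_divide)
    finally show ?thesis using e unfolding v_def x_def y_def by simp
  qed
  have int: "integrable lborel (\<lambda>w. exp (- t * \<Phi> w) * v w)" if "t > 0" for t
    unfolding decomp using KG_diag_integral(1)[OF that e] KG_diag_swap(1)[OF that e] KG_evolve_regularised(1)[OF that e]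
    by (intro Bochner_Integration.integrable_diff Bochner_Integration.integrable_add integrable_divide)
  have eq: "(LINT w|lborel. exp (- t * \<Phi> w) * v w) = (LINT w|lborel. KG_diag F t e w) - (LINT w|lborel. KG_off_diag F t e w)"
    if t: "t > 0" for t
    unfolding decomp using KG_diag_integral(1)[OF t e] KG_diag_swap[OF t e] KG_evolve_regularised(1)[OF t e]
    by simp
  have "cm_chain (\<lambda>k t. LINT w|lborel. (- \<Phi> w) ^ k * (exp (- t * \<Phi> w) * v w))"
    by (rule cm_chain_laplace[OF m]) (use v0 int in \<open>auto simp: \<Phi>_def\<close>)
  then show ?thesis using eq by (intro exI conjI) auto
qed

text \<open>The damping in space-time increases to 1, so monotone convergence gives the limit in
  \<open>ennreal\<close> while an infinite value is still possible.\<close>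

lemma L4pow4_limit:
  assumes t: "t > 0" and e: "\<And>n. e n > 0" "decseq e" "e \<longlonglongrightarrow> 0"
  shows "(\<lambda>n. ennreal (LINT w|lborel. KG_off_diag F t (e n) w / (2 * pi) ^ (4 * DIM('a)))) \<longlonglongrightarrow> L4pow4 F t"
  unfolding KG_evolve_regularised(2)[OF t e(1), symmetric] L4pow4_def lborel_prod
proof (rule nn_integral_LIMSEQ)
  let ?f = "\<lambda>n q. ennreal (cmod (KG_evolve F t (fst q) (snd q)) ^ 4 * exp (- e n * (norm q)\<^sup>2 / 2))"
  have mono: "e n \<le> e m" if "m \<le> n" for m n using e(2) that by (auto simp: decseq_def)
  show "incseq ?f"
    by (intro incseq_SucI le_funI ennreal_leI mult_left_mono) (auto intro!: mult_right_mono mono)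
  have Gm[measurable]: "(\<lambda>x. complex_of_real (exp (- t * phi x)) * F x) \<in> borel_measurable borel" by measurable
  have cism[measurable]: "cis \<in> borel_measurable borel"
    unfolding cis_conv_exp[abs_def] by (intro borel_measurable_continuous_onI continuous_intros)
  have "(\<lambda>q. KG_evolve F t (fst q) (snd q)) \<in> borel_measurable ((borel :: real measure) \<Otimes>\<^sub>M (borel :: 'a measure))"
    unfolding KG_evolve_def by measurable
  then have um[measurable]: "(\<lambda>q. KG_evolve F t (fst q) (snd q)) \<in> borel_measurable (borel :: (real \<times> 'a) measure)"
    by (simp add: borel_prod)
  show "?f n \<in> borel_measurable lborel" for n by measurable
  show "(\<lambda>n. ?f n q) \<longlonglongrightarrow> ennreal (cmod (KG_evolve F t (fst q) (snd q)) ^ 4)" for q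
  proof (rule tendsto_ennrealI)
    have "(\<lambda>n. exp (- e n * (norm q)\<^sup>2 / 2)) \<longlonglongrightarrow> exp (- 0 * (norm q)\<^sup>2 / 2)"
      by (intro tendsto_intros e) auto
    then show "(\<lambda>n. cmod (KG_evolve F t (fst q) (snd q)) ^ 4 * exp (- e n * (norm q)\<^sup>2 / 2))
        \<longlonglongrightarrow> cmod (KG_evolve F t (fst q) (snd q)) ^ 4"
      using tendsto_mult_left by fastforce
  qed
qed

lemma deficit_tendsto:
  assumes t: "t > 0" and e: "\<And>n. e n > 0" "decseq e" "e \<longlonglongrightarrow> 0"
  defines "N \<equiv> (2 * pi) ^ (4 * DIM('a))"
  shows "L4pow4 F t < \<infinity>"
    and "(\<lambda>n. (LINT w|lborel. KG_diag F t (e n) w) / N - (LINT w|lborel. KG_off_diag F t (e n) w) / N) \<longlonglongrightarrow>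
      sphere_area DIM('a) / (2 powr ((real DIM('a) - 1) / 2) * (2 * pi) ^ (3 * DIM('a) - 1))
        * enn2real (I2hat (\<lambda>x. complex_of_real (exp (- t * phi x)) * F x)) - enn2real (L4pow4 F t)"
proof -
  define A where "A n = (LINT w|lborel. KG_diag F t (e n) w) / N" for n
  define L where "L n = (LINT w|lborel. KG_off_diag F t (e n) w) / N" for n
  define I where "I = enn2real (I2hat (\<lambda>x. complex_of_real (exp (- t * phi x)) * F x))"
  define A' where "A' = sphere_area DIM('a) / (2 powr ((real DIM('a) - 1) / 2) * (2 * pi) ^ (3 * DIM('a) - 1)) * I"
  have N: "N > 0" by (simp add: N_def)
  \<comment> \<open>The mass of the Gaussian on space-time cancels d + 1 of the 4d factors from the
    inverse Fourier integrals.\<close>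
  have NN: "N = (2 * pi) ^ (DIM('a) + 1) * (2 * pi) ^ (3 * DIM('a) - 1)"
    unfolding N_def power_add[symmetric] by (rule arg_cong[where f = "\<lambda>k. (2 * pi) ^ k"]) (use d in simp)
  have "(2 * pi) ^ (DIM('a) + 1) * (sphere_area DIM('a) / 2 powr ((real DIM('a) - 1) / 2)) * I / N = A'"
    by (simp add: A'_def NN)
  then have A: "A \<longlonglongrightarrow> A'"
    using tendsto_divide[OF KG_diag_tendsto[OF t e(1,3)] tendsto_const[of N]] N
    unfolding A_def I_def I2hat_damped by simp
  have L: "(\<lambda>n. ennreal (L n)) \<longlonglongrightarrow> L4pow4 F t"
    using L4pow4_limit[OF t e] by (simp add: L_def N_def)
  \<comment> \<open>Order 0 of the chain is nonnegative. As the \<open>A n\<close> converge to a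
    real number, the limit of the \<open>L n\<close> cannot be infinite.\<close>
  have LA: "L n \<le> A n" for n
  proof -
    obtain h where h: "cm_chain h" "\<forall>t>0. h 0 t = (LINT w|lborel. KG_diag F t (e n) w) - (LINT w|lborel. KG_off_diag F t (e n) w)"
      using deficit_chain[OF e(1)] by blast
    then have "(LINT w|lborel. KG_off_diag F t (e n) w) \<le> (LINT w|lborel. KG_diag F t (e n) w)"
      using cm_chain_nonneg[OF h(1) t, of 0] t by simp
    then show ?thesis using N by (simp add: L_def A_def divide_right_mono)
  qed
  have "L4pow4 F t \<le> ennreal A'"
    by (rule LIMSEQ_le[OF L tendsto_ennrealI[OF A]]) (auto intro!: exI[of _ 0] ennreal_leI LA)
  then show fin: "L4pow4 F t < \<infinity>"
    by (metis ennreal_less_top infinity_ennreal_def le_less_trans)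
  have L0: "L n \<ge> 0" for n
    unfolding L_def using KG_evolve_regularised(3)[OF t e(1)] N by simp
  have "(\<lambda>n. enn2real (ennreal (L n))) \<longlonglongrightarrow> enn2real (L4pow4 F t)"
    by (rule tendsto_enn2real) (use fin L in auto)
  then have "L \<longlonglongrightarrow> enn2real (L4pow4 F t)" using L0 by simp
  then show "(\<lambda>n. (LINT w|lborel. KG_diag F t (e n) w) / N - (LINT w|lborel. KG_off_diag F t (e n) w) / N) \<longlonglongrightarrow>
      sphere_area DIM('a) / (2 powr ((real DIM('a) - 1) / 2) * (2 * pi) ^ (3 * DIM('a) - 1))
        * enn2real (I2hat (\<lambda>x. complex_of_real (exp (- t * phi x)) * F x)) - enn2real (L4pow4 F t)"
    using tendsto_diff[OF A] unfolding A_def L_def A'_def I_def by blast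
qed

lemma deficit_completely_monotone:
  "completely_monotone (\<lambda>t.
      sphere_area DIM('a) / (2 powr ((real DIM('a) - 1) / 2) * (2 * pi) ^ (3 * DIM('a) - 1))
        * enn2real (I2hat (\<lambda>x. complex_of_real (exp (- t * phi x)) * F x))
      - enn2real (L4pow4 F t))" (is "completely_monotone ?Q")
proof -
  define e where "e n = inverse (real (Suc n))" for n
  have e: "e n > 0" "decseq e" "e \<longlonglongrightarrow> 0" for n
    unfolding e_def using LIMSEQ_inverse_real_of_nat by (auto simp: decseq_def)
  define N where "N = (2 * pi) ^ (4 * DIM('a))"
  have N: "N > 0" by (simp add: N_def)
  have "\<forall>n. \<exists>h. cm_chain h \<and> (\<forall>t>0. h 0 t = (LINT w|lborel. KG_diag F t (e n) w) / N - (LINT w|lborel. KG_off_diag F t (e n) w) / N)"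
  proof
    fix n
    obtain h where h: "cm_chain h" "\<forall>t>0. h 0 t = (LINT w|lborel. KG_diag F t (e n) w) - (LINT w|lborel. KG_off_diag F t (e n) w)"
      using deficit_chain[OF e(1)] by blast
    have "cm_chain (\<lambda>k t. h k t / N)"
      using h(1) N unfolding cm_chain_def by (auto intro!: DERIV_cdivide simp: zero_le_divide_iff)
    then show "\<exists>h. cm_chain h \<and> (\<forall>t>0. h 0 t = (LINT w|lborel. KG_diag F t (e n) w) / N - (LINT w|lborel. KG_off_diag F t (e n) w) / N)"
      using h(2) by (intro exI[of _ "\<lambda>k t. h k t / N"]) (simp add: diff_divide_distrib)
  qed
  then obtain h where h: "\<And>n. cm_chain (h n)"
      "\<And>n t. t > 0 \<Longrightarrow> h n 0 t = (LINT w|lborel. KG_diag F t (e n) w) / N - (LINT w|lborel. KG_off_diag F t (e n) w) / N"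
    by metis
  have "\<exists>H. cm_chain H \<and> (\<forall>t>0. H 0 t = ?Q t)"
  proof (rule cm_chain_limit[OF h(1)])
    fix t :: real assume t: "t > 0"
    show "(\<lambda>n. h n 0 t) \<longlonglongrightarrow> ?Q t"
      unfolding h(2)[OF t] N_def by (rule deficit_tendsto(2)[OF t e])
  qed
  then obtain H where H: "cm_chain H" "\<And>t. t > 0 \<Longrightarrow> H 0 t = ?Q t" by blast
  show ?thesis by (rule completely_monotoneI[OF H])
qed

end

theorem theorem2p8:
  fixes f F :: "'a::euclidean_space \<Rightarrow> complex"
  assumes "DIM('a) \<ge> 2"
    and "f \<in> borel_measurable lborel"
    and "has_fourier f F"
    and "I2hat F < \<infinity>"
  shows "(\<forall>t>0. L4pow4 F t < \<infinity>) \<and>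
    completely_monotone (\<lambda>t.
      sphere_area DIM('a) / (2 powr ((real DIM('a) - 1) / 2) * (2 * pi) ^ (3 * DIM('a) - 1))
        * enn2real (I2hat (\<lambda>\<xi>. complex_of_real (exp (- t * KG_phi (norm \<xi>))) * F \<xi>))
      - enn2real (L4pow4 F t))"
proof -
  have Fm: "F \<in> borel_measurable lborel" using assms(3) by (simp add: has_fourier_def)
  then have Fb: "F \<in> borel_measurable borel" by simp
  note L1 = has_fourier_exp_integrable[OF assms(3)]
  note L2 = I2hat_finite_imp_integrable[OF assms(1) Fm assms(4)]
  have "L4pow4 F t < \<infinity>" if "t > 0" for t
    by (rule deficit_tendsto(1)[OF assms(1) Fb L1 L2 that _ _ LIMSEQ_inverse_real_of_nat])
       (auto simp: decseq_def)
  then show ?thesis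
    using deficit_completely_monotone[OF assms(1) Fb L1 L2] by blast
qed

end
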